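(* Let $u\in\mathscr C^2(\Gamma)$ be a solution to $$\begin{cases}-\mu_\alpha\partial^2u(x)+H(x,\partial u(x))+\lambda u(x)=F(x)&\text{for all }x\in\Gamma_\alpha\setminus\mathcal V,\ \alpha\in\mathcal A,\\ u_{|\Gamma_\alpha}(v)=u_{|\Gamma_\beta}(v)&\text{for all }\alpha,\beta\in\mathcal A_v,\ v\in\mathcal V,\\ \sum_{\alpha\in\mathcal A_v}\mu_\alpha\gamma_{v,\alpha}\,\partial_\alpha u(v)=\eta_v(\theta_v-\lambda u(v))&\text{for all }v\in\mathcal V\setminus\partial\mathcal V,\\ \partial_\alpha u(v)=0&\text{for all }v\in\partial\mathcal V,\ \alpha\in\mathcal A_v,\end{cases}$$ where $H_\alpha(x,p)=\sup_{|a|\le R}\{-b_\alpha(x,a)p-\ell_\alpha(x,a)\}$ for $\alpha\in\mathcal A$ (and $H=H_\alpha$ on $\Gamma_\alpha$). Then, for every $a\in\mathfrak A$, $u(x)\le J(x,a)$ for all $x\in\Gamma$. In particular $u(x)\le V(x)$, where $V(x)=\inf_{a\in\mathfrak A}J(x,a)$.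
   Context: Network. $\mathcal V\subset\mathbb R^d$ is a finite set of vertices; $P\subset\mathcal V\times\mathcal V$ contains no pair $(v,v)$, and every vertex occurs in at least one pair of $P$. The edges are the segments joining the two points of a pair in $P$, indexed as $\Gamma_\alpha$, $\alpha\in\mathcal A$ ($\mathcal A$ finite); for $\alpha\ne\beta$, $\Gamma_\alpha\cap\Gamma_\beta=\{v\}$ if both edges contain the vertex $v$, and $\Gamma_\alpha\cap\Gamma_\beta=\varnothing$ otherwise. The network $\Gamma=\bigcup_{\alpha}\Gamma_\alpha$ is assumed connected and carries its geodesic distance. $\mathcal A_v=\{\alpha\in\mathcal A: v\in\Gamma_\alpha\}$; $\partial\mathcal V$ is the set of boundary vertices, i.e. those $v$ for which there is a unique $\bar v\in\mathcal V$ with $(v,\bar v)\in P$ or $(\bar v,v)\in P$. An edge $\Gamma_\alpha$ with vertices $v_i,v_j$ and length $L_\alpha$ is parametrized by $\pi_\alpha(s)=v_i+s\,e_\alpha$, $e_\alpha=(v_j-v_i)/L_\alpha$, $s\in[0,L_\alpha]$. For $u:\Gamma\to\mathbb R$, $u_\alpha=u\circ\pi_\alpha$ on $(0,L_\alpha)$, and $u_{|\Gamma_\alpha}(v)$ is the limit of $u_\alpha$ at the endpoint corresponding to $v\in\Gamma_\alpha$. $\partial u$, $\partial^2u$ inside $\Gamma_\alpha$ are derivatives of $u_\alpha$ with respect to $s$. At a vertex $v\in\Gamma_\alpha$, $\partial_\alpha u(v)$ is the outward derivative: $-u_\alpha'(0)$ if $v=\pi_\alpha(0)$, $u_\alpha'(L_\alpha)$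 if $v=\pi_\alpha(L_\alpha)$. Spaces. $\mathscr C(\Gamma)$: continuous functions on $\Gamma$. $\mathscr C^k(\Gamma)$: continuous functions on $\Gamma$ with $u_\alpha\in C^k([0,L_\alpha])$ for all $\alpha$. $\mathcal{PC}(\Gamma)$: functions $u:\Gamma\to\mathbb R$ with each $u_\alpha$ continuous on $(0,L_\alpha)$ with finite limits at the endpoints, $\|u\|_{\mathcal{PC}(\Gamma)}=\max_\alpha\|u_\alpha\|_{L^\infty(0,L_\alpha)}$; $PC(\Gamma)$ is its quotient identifying functions that agree on the interior of every edge. Data. $\lambda>0$; $\mu_\alpha>0$ for $\alpha\in\mathcal A$; for $v\in\mathcal V\setminus\partial\mathcal V$ and $\alpha\in\mathcal A_v$: $\gamma_{v,\alpha}>0$, $\eta_v\ge0$, $\theta_v\in\mathbb R$, with $\sum_{\alpha\in\mathcal A_v}\mu_\alpha\gamma_{v,\alpha}=1$. $b:\Gamma\times\mathbb R\to\mathbb R$ and $\ell:\Gamma\times\mathbb R\to\mathbb R$ have continuous restrictions $b_\alpha,\ell_\alpha$ to $\Gamma_\alpha\times\mathbb R$ for every $\alpha$. $F\in PC(\Gamma)$. $R>0$ and the set of controls is $\mathfrak A=\{a\in\mathcal{PC}(\Gamma):\|a\|_{\mathcal{PC}(\Gamma)}\le R\}$. Controlled process. For $a\in\mathfrak A$, let $\mathcal G^a$ be the operator $\mathcal G^a f(x)=\mu_\alpha\partial^2f(x)+b_\alpha(x,a_\alpha(x))\,\partial f(x)$, $x\in\Gamma_\alpha\setminus\mathcal V$,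 $\alpha\in\mathcal A$, with domain $D(\mathcal G^a)$ the set of $f\in\mathscr C^2(\Gamma)$ such that $\mathcal G^af\in\mathscr C(\Gamma)$ (i.e. extends continuously to $\Gamma$), $\eta_v\mathcal G^af(v)+\sum_{\alpha\in\mathcal A_v}\mu_\alpha\gamma_{v,\alpha}\partial_\alpha f(v)=0$ for all $v\in\mathcal V\setminus\partial\mathcal V$, and $\partial_\alpha f(v)=0$ for all $v\in\partial\mathcal V$. It is known that $\mathcal G^a$ generates a Feller (strong Markov) process on $\Gamma$ with continuous paths; $X^a$ denotes this process with initial distribution $\delta_x$, and $\mathbb E_x$ the expectation. Cost. For $x\in\Gamma$, $a\in\mathfrak A$, $$J(x,a)=\mathbb E_x\Big[\int_0^{+\infty}e^{-\lambda s}\Big(\big(\ell(X^a(s),a(X^a(s)))+F(X^a(s))\big)\mathbf 1_{\{X^a(s)\notin\mathcal V\}}+\sum_{v\in\mathcal V\setminus\partial\mathcal V}\theta_v\mathbf 1_{\{X^a(s)=v\}}\Big)ds\Big].$$ *)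

theory Defs
  imports "HOL-Probability.Probability"
begin

section \<open>Networks\<close>

text \<open>
  The edges are indexed by a set of abstract labels. The edge with label \<open>\<alpha>\<close> is the segment
  from \<open>source N \<alpha>\<close> to \<open>target N \<alpha>\<close>, parametrized by arc length from its source; a pair of
  \<open>pairs N\<close> does not prescribe the orientation of its edge.
\<close>

record ('a, 'e) network =
  verts :: "'a set"
  pairs :: "('a \<times> 'a) set"
  edges :: "'e set"
  source :: "'e \<Rightarrow> 'a"
  target :: "'e \<Rightarrow> 'a"

definition seg :: "('a::euclidean_space, 'e, 'z) network_scheme \<Rightarrow> 'e \<Rightarrow> 'a set" where
  "seg N \<alpha> = closed_segment (source N \<alpha>) (target N \<alpha>)"

definition net_set :: "('a::euclidean_space, 'e, 'z) network_scheme \<Rightarrow> 'a set" where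
  "net_set N = (\<Union>\<alpha>\<in>edges N. seg N \<alpha>)"

definition adjacent :: "('a, 'e, 'z) network_scheme \<Rightarrow> 'a \<Rightarrow> 'a \<Rightarrow> bool" where
  "adjacent N v w \<longleftrightarrow> (v, w) \<in> pairs N \<or> (w, v) \<in> pairs N"

definition boundary_verts :: "('a, 'e, 'z) network_scheme \<Rightarrow> 'a set" where
  "boundary_verts N = {v \<in> verts N. \<exists>!w. w \<in> verts N \<and> adjacent N v w}"

definition inner_verts :: "('a, 'e, 'z) network_scheme \<Rightarrow> 'a set" where
  "inner_verts N = verts N - boundary_verts N"

definition edges_at :: "('a::euclidean_space, 'e, 'z) network_scheme \<Rightarrow> 'a \<Rightarrow> 'e set" where
  "edges_at N v = {\<alpha> \<in> edges N. v \<in> seg N \<alpha>}"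

text \<open>
  The condition \<open>seg N \<alpha> \<inter> verts N \<subseteq> {source N \<alpha>, target N \<alpha>}\<close> says that an edge
  contains a vertex only as one of its two endpoints. Connectedness, and continuity on
  \<open>net_set N\<close> throughout, refer to the Euclidean subspace topology: on a finite union of segments
  meeting only in common endpoints it coincides with the topology of the geodesic distance.
\<close>

definition is_network :: "('a::euclidean_space, 'e, 'z) network_scheme \<Rightarrow> bool" where
  "is_network N \<longleftrightarrow>
     finite (verts N) \<and> finite (edges N) \<and>
     pairs N \<subseteq> verts N \<times> verts N \<and>
     (\<forall>v. (v, v) \<notin> pairs N) \<and>
     (\<forall>v\<in>verts N. \<exists>w. adjacent N v w) \<and>
     (\<forall>\<alpha>\<in>edges N. adjacent N (source N \<alpha>) (target N \<alpha>)) \<and>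
     (\<forall>(v, w)\<in>pairs N. \<exists>\<alpha>\<in>edges N. seg N \<alpha> = closed_segment v w) \<and>
     (\<forall>\<alpha>\<in>edges N. seg N \<alpha> \<inter> verts N \<subseteq> {source N \<alpha>, target N \<alpha>}) \<and>
     (\<forall>\<alpha>\<in>edges N. \<forall>\<beta>\<in>edges N. \<alpha> \<noteq> \<beta> \<longrightarrow>
        (\<forall>v\<in>verts N. v \<in> seg N \<alpha> \<and> v \<in> seg N \<beta> \<longrightarrow> seg N \<alpha> \<inter> seg N \<beta> = {v}) \<and>
        ((\<forall>v\<in>verts N. \<not> (v \<in> seg N \<alpha> \<and> v \<in> seg N \<beta>)) \<longrightarrow> seg N \<alpha> \<inter> seg N \<beta> = {})) \<and>
     connected (net_set N)"


section \<open>Functions on a network\<close>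

text \<open>
  Functions on the network are functions on the ambient space of which only the values on
  \<open>net_set N\<close> matter.
\<close>

definition len :: "('a::euclidean_space, 'e, 'z) network_scheme \<Rightarrow> 'e \<Rightarrow> real" where
  "len N \<alpha> = dist (source N \<alpha>) (target N \<alpha>)"

definition param :: "('a::euclidean_space, 'e, 'z) network_scheme \<Rightarrow> 'e \<Rightarrow> real \<Rightarrow> 'a" where
  "param N \<alpha> s = source N \<alpha> + s *\<^sub>R ((target N \<alpha> - source N \<alpha>) /\<^sub>R len N \<alpha>)"

definition on_edge ::
  "('a::euclidean_space, 'e, 'z) network_scheme \<Rightarrow> 'e \<Rightarrow> ('a \<Rightarrow> real) \<Rightarrow> real \<Rightarrow> real" where
  "on_edge N \<alpha> u = (\<lambda>s. u (param N \<alpha> s))"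

definition Ck_interval :: "nat \<Rightarrow> real \<Rightarrow> (real \<Rightarrow> real) \<Rightarrow> bool" where
  "Ck_interval k L f \<longleftrightarrow>
     (\<exists>D. (\<forall>s\<in>{0..L}. D 0 s = f s) \<and>
          (\<forall>i<k. \<forall>s\<in>{0..L}. (D i has_real_derivative D (Suc i) s) (at s within {0..L})) \<and>
          continuous_on {0..L} (D k))"

definition C_net :: "('a::euclidean_space, 'e, 'z) network_scheme \<Rightarrow> ('a \<Rightarrow> real) set" where
  "C_net N = {u. continuous_on (net_set N) u}"

definition Ck_net ::
  "nat \<Rightarrow> ('a::euclidean_space, 'e, 'z) network_scheme \<Rightarrow> ('a \<Rightarrow> real) set" where
  "Ck_net k N = {u \<in> C_net N. \<forall>\<alpha>\<in>edges N. Ck_interval k (len N \<alpha>) (on_edge N \<alpha> u)}"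

definition PC_net :: "('a::euclidean_space, 'e, 'z) network_scheme \<Rightarrow> ('a \<Rightarrow> real) set" where
  "PC_net N = {u. \<forall>\<alpha>\<in>edges N. continuous_on {0<..<len N \<alpha>} (on_edge N \<alpha> u) \<and>
       (\<exists>l. (on_edge N \<alpha> u \<longlongrightarrow> l) (at_right 0)) \<and>
       (\<exists>l. (on_edge N \<alpha> u \<longlongrightarrow> l) (at_left (len N \<alpha>)))}"

definition PC_norm ::
  "('a::euclidean_space, 'e, 'z) network_scheme \<Rightarrow> ('a \<Rightarrow> real) \<Rightarrow> ereal" where
  "PC_norm N u =
     (MAX \<alpha>\<in>edges N. esssup (restrict_space lborel {0<..<len N \<alpha>})
                         (\<lambda>s. ereal \<bar>on_edge N \<alpha> u s\<bar>))"

text \<open>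
  \<open>edge_deriv k N \<alpha> u x\<close> is the \<open>k\<close>-th derivative of \<open>u\<close> along the edge \<open>\<alpha>\<close>
  at the point \<open>x\<close> of that edge, whose parameter is its distance from the source; at the endpoints
  the derivatives are one-sided.
\<close>

definition interval_deriv :: "real \<Rightarrow> (real \<Rightarrow> real) \<Rightarrow> real \<Rightarrow> real" where
  "interval_deriv L f s = vector_derivative f (at s within {0..L})"

definition edge_deriv ::
  "nat \<Rightarrow> ('a::euclidean_space, 'e, 'z) network_scheme \<Rightarrow> 'e \<Rightarrow> ('a \<Rightarrow> real) \<Rightarrow> 'a \<Rightarrow> real"
where
  "edge_deriv k N \<alpha> u x =
     (interval_deriv (len N \<alpha>) ^^ k) (on_edge N \<alpha> u) (dist (source N \<alpha>) x)"

definition outward_deriv ::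
  "('a::euclidean_space, 'e, 'z) network_scheme \<Rightarrow> 'e \<Rightarrow> ('a \<Rightarrow> real) \<Rightarrow> 'a \<Rightarrow> real" where
  "outward_deriv N \<alpha> u v =
     (if v = source N \<alpha> then - interval_deriv (len N \<alpha>) (on_edge N \<alpha> u) 0
      else interval_deriv (len N \<alpha>) (on_edge N \<alpha> u) (len N \<alpha>))"

definition edge_trace ::
  "('a::euclidean_space, 'e, 'z) network_scheme \<Rightarrow> 'e \<Rightarrow> ('a \<Rightarrow> real) \<Rightarrow> 'a \<Rightarrow> real" where
  "edge_trace N \<alpha> u v =
     (if v = source N \<alpha> then Lim (at_right 0) (on_edge N \<alpha> u)
      else Lim (at_left (len N \<alpha>)) (on_edge N \<alpha> u))"


section \<open>Data of the control problem\<close>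

text \<open>
  The fields are, in this order, \<open>\<lambda>\<close>, \<open>\<mu>\<^sub>\<alpha>\<close>, \<open>\<gamma>\<close> (vertex, then edge), \<open>\<eta>\<^sub>v\<close>,
  \<open>\<theta>\<^sub>v\<close>, \<open>b\<close>, \<open>\<ell>\<close>, \<open>F\<close> and \<open>R\<close>. An element of the quotient space of piecewise
  continuous functions is given by a representative \<open>F\<close>; its values at the vertices are never used.
\<close>

record ('a, 'e) control_problem = "('a, 'e) network" +
  discount :: real
  diffusivity :: "'e \<Rightarrow> real"
  weight :: "'a \<Rightarrow> 'e \<Rightarrow> real"
  stickiness :: "'a \<Rightarrow> real"
  vertex_cost :: "'a \<Rightarrow> real"
  drift :: "'a \<Rightarrow> real \<Rightarrow> real"
  running_cost :: "'a \<Rightarrow> real \<Rightarrow> real"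
  extra_cost :: "'a \<Rightarrow> real"
  control_bound :: real

definition is_control_problem ::
  "('a::euclidean_space, 'e, 'z) control_problem_scheme \<Rightarrow> bool" where
  "is_control_problem N \<longleftrightarrow>
     is_network N \<and>
     discount N > 0 \<and>
     (\<forall>\<alpha>\<in>edges N. diffusivity N \<alpha> > 0) \<and>
     (\<forall>v\<in>inner_verts N.
        (\<forall>\<alpha>\<in>edges_at N v. weight N v \<alpha> > 0) \<and>
        stickiness N v \<ge> 0 \<and>
        (\<Sum>\<alpha>\<in>edges_at N v. diffusivity N \<alpha> * weight N v \<alpha>) = 1) \<and>
     (\<forall>\<alpha>\<in>edges N. continuous_on (seg N \<alpha> \<times> UNIV) (\<lambda>(x, a). drift N x a)) \<and>
     (\<forall>\<alpha>\<in>edges N. continuous_on (seg N \<alpha> \<times> UNIV) (\<lambda>(x, a). running_cost N x a)) \<and>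
     extra_cost N \<in> PC_net N \<and>
     control_bound N > 0"

definition controls ::
  "('a::euclidean_space, 'e, 'z) control_problem_scheme \<Rightarrow> ('a \<Rightarrow> real) set" where
  "controls N = {a \<in> PC_net N. PC_norm N a \<le> ereal (control_bound N)}"

definition hamiltonian ::
  "('a::euclidean_space, 'e, 'z) control_problem_scheme \<Rightarrow> 'a \<Rightarrow> real \<Rightarrow> real" where
  "hamiltonian N x p =
     (SUP a\<in>{a. \<bar>a\<bar> \<le> control_bound N}. - drift N x a * p - running_cost N x a)"

definition HJB_solution ::
  "('a::euclidean_space, 'e, 'z) control_problem_scheme \<Rightarrow> ('a \<Rightarrow> real) \<Rightarrow> bool" where
  "HJB_solution N u \<longleftrightarrow>
     (\<forall>\<alpha>\<in>edges N. \<forall>x\<in>seg N \<alpha> - verts N.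
        - diffusivity N \<alpha> * edge_deriv 2 N \<alpha> u x + hamiltonian N x (edge_deriv 1 N \<alpha> u x)
          + discount N * u x = extra_cost N x) \<and>
     (\<forall>v\<in>verts N. \<forall>\<alpha>\<in>edges_at N v. \<forall>\<beta>\<in>edges_at N v. edge_trace N \<alpha> u v = edge_trace N \<beta> u v) \<and>
     (\<forall>v\<in>inner_verts N.
        (\<Sum>\<alpha>\<in>edges_at N v. diffusivity N \<alpha> * weight N v \<alpha> * outward_deriv N \<alpha> u v)
          = stickiness N v * (vertex_cost N v - discount N * u v)) \<and>
     (\<forall>v\<in>boundary_verts N. \<forall>\<alpha>\<in>edges_at N v. outward_deriv N \<alpha> u v = 0)"

text \<open>
  The graph of the operator \<open>\<G>\<^sup>a\<close>: the pairs \<open>(f, g)\<close> in which \<open>f\<close> belongs to the domain and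
  \<open>g\<close> is the continuous extension of \<open>\<G>\<^sup>a f\<close> to the network (vertices included).
\<close>

definition controlled_operator ::
  "('a::euclidean_space, 'e, 'z) control_problem_scheme \<Rightarrow> ('a \<Rightarrow> real)
     \<Rightarrow> (('a \<Rightarrow> real) \<times> ('a \<Rightarrow> real)) set" where
  "controlled_operator N a = {(f, g). f \<in> Ck_net 2 N \<and> g \<in> C_net N \<and>
     (\<forall>\<alpha>\<in>edges N. \<forall>x\<in>seg N \<alpha> - verts N.
        g x = diffusivity N \<alpha> * edge_deriv 2 N \<alpha> f x + drift N x (a x) * edge_deriv 1 N \<alpha> f x) \<and>
     (\<forall>v\<in>inner_verts N.
        stickiness N v * g v
          + (\<Sum>\<alpha>\<in>edges_at N v. diffusivity N \<alpha> * weight N v \<alpha> * outward_deriv N \<alpha> f v) = 0) \<and>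
     (\<forall>v\<in>boundary_verts N. \<forall>\<alpha>\<in>edges_at N v. outward_deriv N \<alpha> f v = 0)}"


section \<open>Feller processes\<close>

text \<open>
  Feller semigroups on the space of continuous functions on a compact set \<open>S\<close>. A function on \<open>S\<close>
  is again a function on the ambient type considered on \<open>S\<close> only; linearity and the two-sided
  bound imply that \<open>T t f\<close> on \<open>S\<close> depends only on \<open>f\<close> on \<open>S\<close>.
\<close>

definition feller_semigroup ::
  "'a::topological_space set \<Rightarrow> (real \<Rightarrow> ('a \<Rightarrow> real) \<Rightarrow> 'a \<Rightarrow> real) \<Rightarrow> bool" where
  "feller_semigroup S T \<longleftrightarrow>
     (\<forall>t\<ge>0. \<forall>f. continuous_on S f \<longrightarrow> continuous_on S (T t f)) \<and>
     (\<forall>t\<ge>0. \<forall>f g c. continuous_on S f \<longrightarrow> continuous_on S g \<longrightarrow>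
        (\<forall>x\<in>S. T t (\<lambda>y. c * f y + g y) x = c * T t f x + T t g x)) \<and>
     (\<forall>t\<ge>0. \<forall>f. continuous_on S f \<longrightarrow> (\<forall>x\<in>S. 0 \<le> f x \<and> f x \<le> 1) \<longrightarrow>
        (\<forall>x\<in>S. 0 \<le> T t f x \<and> T t f x \<le> 1)) \<and>
     (\<forall>f. continuous_on S f \<longrightarrow> (\<forall>x\<in>S. T 0 f x = f x)) \<and>
     (\<forall>s\<ge>0. \<forall>t\<ge>0. \<forall>f. continuous_on S f \<longrightarrow> (\<forall>x\<in>S. T (s + t) f x = T s (T t f) x)) \<and>
     (\<forall>f. continuous_on S f \<longrightarrow> uniform_limit S (\<lambda>t. T t f) f (at_right 0))"

definition infinitesimal_generator ::
  "'a::topological_space set \<Rightarrow> (real \<Rightarrow> ('a \<Rightarrow> real) \<Rightarrow> 'a \<Rightarrow> real)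
     \<Rightarrow> (('a \<Rightarrow> real) \<times> ('a \<Rightarrow> real)) set" where
  "infinitesimal_generator S T = {(f, g). continuous_on S f \<and> continuous_on S g \<and>
     uniform_limit S (\<lambda>t x. (T t f x - f x) / t) g (at_right 0)}"

definition natural_filtration ::
  "'w measure \<Rightarrow> (real \<Rightarrow> 'w \<Rightarrow> 'a::topological_space) \<Rightarrow> real \<Rightarrow> 'w measure" where
  "natural_filtration M X t =
     sigma (space M) {X s -` B \<inter> space M | s B. 0 \<le> s \<and> s \<le> t \<and> B \<in> sets borel}"

text \<open>
  \<open>feller_process M X S G x\<close>: on the probability space \<open>M\<close>, \<open>(X t)\<close> for \<open>t \<ge> 0\<close> is an
  \<open>S\<close>-valued Markov process with continuous paths and initial distribution the Dirac mass at \<open>x\<close>,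
  whose transition semigroup is a Feller semigroup with infinitesimal generator (as a graph) \<open>G\<close>.
\<close>

definition feller_process ::
  "'w measure \<Rightarrow> (real \<Rightarrow> 'w \<Rightarrow> 'a::euclidean_space) \<Rightarrow> 'a set
     \<Rightarrow> (('a \<Rightarrow> real) \<times> ('a \<Rightarrow> real)) set \<Rightarrow> 'a \<Rightarrow> bool" where
  "feller_process M X S G x \<longleftrightarrow>
     prob_space M \<and>
     (\<forall>t\<ge>0. X t \<in> measurable M borel) \<and>
     (\<forall>t\<ge>0. \<forall>\<omega>\<in>space M. X t \<omega> \<in> S) \<and>
     (\<forall>\<omega>\<in>space M. continuous_on {0..} (\<lambda>t. X t \<omega>)) \<and>
     distr M borel (X 0) = return borel x \<and>
     (\<exists>T. feller_semigroup S T \<and> infinitesimal_generator S T = G \<and>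
        (\<forall>s\<ge>0. \<forall>t\<ge>0. \<forall>f. continuous_on S f \<longrightarrow>
           (AE \<omega> in M. real_cond_exp M (natural_filtration M X s) (\<lambda>\<omega>'. f (X (s + t) \<omega>')) \<omega>
                        = T t f (X s \<omega>))))"


section \<open>Cost and value function\<close>

definition cost ::
  "('a::euclidean_space, 'e, 'z) control_problem_scheme \<Rightarrow> 'w measure \<Rightarrow> (real \<Rightarrow> 'w \<Rightarrow> 'a)
     \<Rightarrow> ('a \<Rightarrow> real) \<Rightarrow> real" where
  "cost N M X a =
     (LINT \<omega>|M. (LINT s:{0..}|lborel. exp (- discount N * s) *
        ((running_cost N (X s \<omega>) (a (X s \<omega>)) + extra_cost N (X s \<omega>))
            * indicator (- verts N) (X s \<omega>)
         + (\<Sum>v\<in>inner_verts N. vertex_cost N v * indicator {v} (X s \<omega>)))))"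

text \<open>
  In the value function, \<open>X a x\<close> on the probability space \<open>M a x\<close> is the process controlled by
  \<open>a\<close> and started at \<open>x\<close>.
\<close>

definition value_function ::
  "('a::euclidean_space, 'e, 'z) control_problem_scheme
     \<Rightarrow> (('a \<Rightarrow> real) \<Rightarrow> 'a \<Rightarrow> 'w measure) \<Rightarrow> (('a \<Rightarrow> real) \<Rightarrow> 'a \<Rightarrow> real \<Rightarrow> 'w \<Rightarrow> 'a)
     \<Rightarrow> 'a \<Rightarrow> real" where
  "value_function N M X x = (INF a\<in>controls N. cost N (M a x) (X a x) a)"

end

theory Submission
  imports Defs
begin

text \<open>
  Fix a control \<open>a\<close> and a starting point \<open>x\<close>, and let \<open>\<nu>\<close> be the law of \<open>X \<tau>\<close>, where \<open>\<tau>\<close> is an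
  exponential time with parameter \<open>\<lambda>\<close> that is independent of the process. The cost is
  \<open>J(x, a) = (1 / \<lambda>) \<integral> k d\<nu>\<close>, where \<open>k\<close> is the running cost including the vertex costs. The
  measure \<open>\<nu>\<close> is governed by the resolvent identity \<open>\<lambda> f(x) = \<integral> (\<lambda> f - g) d\<nu>\<close> for all pairs
  \<open>(f, g)\<close> in the generator (lemma \<open>generator_occupation\<close>), which follows from the Markov property
  at fixed times and the definition of the generator.

  Inside the edges the Hamilton-Jacobi-Bellman equation contains the inequality
  \<open>\<lambda> u - \<G>\<^sup>a u \<le> k\<close>, because \<open>a(x)\<close> competes in the Hamiltonian. If \<open>u\<close> were in the domain of
  \<open>\<G>\<^sup>a\<close>, integrating it for \<open>\<nu>\<close> would finish the proof. But \<open>\<G>\<^sup>a u\<close> may have different limits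
  at a vertex along different edges, none of which need be the value \<open>\<lambda> u(v) - \<theta>\<^sub>v\<close> that the
  Kirchhoff condition attributes to it at a vertex with \<open>\<eta>\<^sub>v > 0\<close>.

  The resolvent identity however survives bounded pointwise limits of \<open>f\<close> and \<open>g\<close>, and under such
  limits the continuity of \<open>g\<close> at the vertices is lost while the vertex condition remains (lemma
  \<open>relaxed_operator_approximation\<close>): perturb \<open>f\<close> near the end of an edge by a function that is flat to
  first order at the vertex and has a prescribed second derivative there, with bounded second
  derivatives and shrinking influence. This moves the limits of \<open>\<G>\<^sup>a f\<close> to any prescribed value and
  leaves the outward derivatives alone.

  So the identity holds for \<open>u\<close> together with the discontinuous function that is \<open>\<G>\<^sup>a u\<close> inside the
  edges and \<open>\<lambda> u(v) - \<theta>\<^sub>v\<close> at the sticky vertices. It also holds for \<open>f = 0\<close> and \<open>g\<close> the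
  indicator of a vertex \<open>v\<close> that is not sticky, which says \<open>\<nu> {v} = 0\<close> and disposes of the
  vertices where \<open>\<lambda> u - \<G>\<^sup>a u\<close> and \<open>k\<close> are unrelated.
\<close>

section \<open>The law at an independent exponential time\<close>

locale continuous_process = prob_space M
  for M :: "'w measure" and X :: "real \<Rightarrow> 'w \<Rightarrow> 'a::euclidean_space" and S :: "'a set" +
  fixes lam :: real
  assumes compact_S: "compact S"
    and lam_pos: "0 < lam"
    and X_measurable: "\<And>t. 0 \<le> t \<Longrightarrow> X t \<in> borel_measurable M"
    and X_in: "\<And>t \<omega>. 0 \<le> t \<Longrightarrow> \<omega> \<in> space M \<Longrightarrow> X t \<omega> \<in> S"
    and X_continuous: "\<And>\<omega>. \<omega> \<in> space M \<Longrightarrow> continuous_on {0..} (\<lambda>t. X t \<omega>)"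
begin

text \<open>
  The occupation measure below is the law of the process at a time \<open>\<tau>\<close> that is independent of the
  path and exponential with parameter \<open>lam\<close>. It turns discounted time integrals into expectations:
  \<open>E \<integral>\<^sub>0\<^sup>\<infinity> exp (- lam s) h (X s) ds = E h (X \<tau>) / lam\<close>. The truncation \<open>max 0 s\<close> only makes
  the path total in time: the clock does not charge negative times.
\<close>

abbreviation clock :: "real measure" where
  "clock \<equiv> density lborel (exponential_density lam)"

definition occupation :: "'a measure" where
  "occupation = distr (M \<Otimes>\<^sub>M clock) borel (\<lambda>(\<omega>, s). X (max 0 s) \<omega>)"

lemma prob_space_clock: "prob_space clock"
  using lam_pos by (rule prob_space_exponential_density)

text \<open>
  Left-point discretisations of the time variable are jointly measurable because they take countably
  many values, and by path continuity they converge to the process.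
\<close>

lemma jointly_measurable [measurable]:
  "(\<lambda>p. X (max 0 (snd p)) (fst p)) \<in> borel_measurable (M \<Otimes>\<^sub>M (borel :: real measure))"
proof (rule borel_measurable_LIMSEQ_metric)
  fix n :: nat
  have "(\<lambda>p. X (real (nat \<lfloor>snd p * Suc n\<rfloor>) / Suc n) (fst p))
          \<in> borel_measurable (M \<Otimes>\<^sub>M (borel :: real measure))"
    by (rule measurable_compose_countable[where f = "\<lambda>i p. X (real i / Suc n) (fst p)"])
       (auto intro!: measurable_compose[OF measurable_fst] X_measurable)
  then show "(\<lambda>p. X (real (nat \<lfloor>snd p * Suc n\<rfloor>) / Suc n) (fst p))
          \<in> borel_measurable (M \<Otimes>\<^sub>M (borel :: real measure))" .
next
  fix p :: "'w \<times> real" assume p: "p \<in> space (M \<Otimes>\<^sub>M borel)"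
  let ?s = "snd p" and ?r = "\<lambda>n::nat. real (nat \<lfloor>snd p * Suc n\<rfloor>) / Suc n"
  have bound: "\<bar>?r n - max 0 ?s\<bar> \<le> 1 / Suc n" for n
  proof (cases "0 \<le> ?s")
    case True
    have "\<bar>of_int \<lfloor>?s * Suc n\<rfloor> - ?s * Suc n\<bar> \<le> 1"
      by linarith
    then have "\<bar>(of_int \<lfloor>?s * Suc n\<rfloor> - ?s * Suc n) / Suc n\<bar> \<le> 1 / Suc n"
      by (simp only: abs_divide) (simp add: divide_right_mono del: of_nat_Suc)
    moreover have "?r n - max 0 ?s = (of_int \<lfloor>?s * Suc n\<rfloor> - ?s * Suc n) / Suc n"
      using True by (simp add: diff_divide_distrib del: of_nat_Suc)
    ultimately show ?thesis by simp
  next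
    case False
    then have "?s * Suc n \<le> 0"
      by (intro mult_nonpos_nonneg) auto
    then have "\<lfloor>?s * Suc n\<rfloor> \<le> 0"
      by linarith
    with False show ?thesis by simp
  qed
  have "(\<lambda>n. ?r n) \<longlonglongrightarrow> max 0 ?s"
    by (rule LIM_zero_cancel, rule tendsto_rabs_zero_cancel,
        rule tendsto_sandwich[OF _ _ tendsto_const LIMSEQ_inverse_real_of_nat])
       (use bound in \<open>auto simp: inverse_eq_divide\<close>)
  moreover have "fst p \<in> space M" using p by (auto simp: space_pair_measure)
  ultimately show "(\<lambda>n. X (?r n) (fst p)) \<longlonglongrightarrow> X (max 0 ?s) (fst p)"
    using X_continuous[of "fst p"]
    by (intro continuous_on_tendsto_compose[where f = "\<lambda>t. X t (fst p)" and s = "{0..}"]) auto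
qed

lemma jointly_measurable_clock:
  "(\<lambda>(\<omega>, s). X (max 0 s) \<omega>) \<in> borel_measurable (M \<Otimes>\<^sub>M clock)"
  using jointly_measurable
  by (simp add: case_prod_beta cong: measurable_cong_sets)

lemma sets_occupation [measurable_cong, simp]: "sets occupation = sets borel"
  by (simp add: occupation_def)

lemma prob_space_occupation: "prob_space occupation"
proof -
  interpret clock: prob_space clock by (rule prob_space_clock)
  interpret pair_prob_space M clock ..
  show ?thesis unfolding occupation_def
    by (rule prob_space_distr[OF jointly_measurable_clock])
qed

lemma integral_clock:
  fixes f :: "real \<Rightarrow> real"
  assumes "f \<in> borel_measurable borel"
  shows "(LINT s|clock. f s) = lam * (LINT s:{0..}|lborel. exp (- lam * s) * f s)"
proof -
  have "(LINT s|clock. f s) = (LINT s|lborel. exponential_density lam s * f s)"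
    using assms lam_pos
    by (subst integral_density) (auto simp: exponential_density_nonneg)
  also have "\<dots> = (LINT s|lborel. lam * (indicator {0..} s * (exp (- lam * s) * f s)))"
    by (intro Bochner_Integration.integral_cong)
       (auto simp: exponential_density_def indicator_def mult_ac)
  finally show ?thesis by (simp add: set_lebesgue_integral_def)
qed

text \<open>
  The two orders of integration over path and time. The first is the form of the cost, the second
  gives access to the one-dimensional marginals, which is all that the Markov property controls.
\<close>

lemma
  fixes h :: "'a \<Rightarrow> real"
  assumes h: "h \<in> borel_measurable borel" and bound: "\<And>y. \<bar>h y\<bar> \<le> C"
  shows occupation_integral_paths:
      "(LINT y|occupation. h y) = lam * (LINT \<omega>|M. (LINT s:{0..}|lborel. exp (- lam * s) * h (X s \<omega>)))"
    and occupation_integral_marginals: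
      "(LINT y|occupation. h y) = lam * (LINT s:{0..}|lborel. exp (- lam * s) * (LINT \<omega>|M. h (X s \<omega>)))"
proof -
  interpret clock: prob_space clock by (rule prob_space_clock)
  interpret P: pair_prob_space M clock ..
  note [measurable] = h
  have meas: "(\<lambda>p. h (X (max 0 (snd p)) (fst p))) \<in> borel_measurable (M \<Otimes>\<^sub>M (borel :: real measure))"
    by measurable
  have int: "integrable (M \<Otimes>\<^sub>M clock) (\<lambda>(\<omega>, s). h (X (max 0 s) \<omega>))"
  proof (rule P.integrable_const_bound[where B = C])
    show "(\<lambda>(\<omega>, s). h (X (max 0 s) \<omega>)) \<in> borel_measurable (M \<Otimes>\<^sub>M clock)"
      using meas by (simp add: case_prod_beta cong: measurable_cong_sets)
  qed (use bound in auto)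
  have push: "(LINT y|occupation. h y) = (LINT p|(M \<Otimes>\<^sub>M clock). (case p of (\<omega>, s) \<Rightarrow> h (X (max 0 s) \<omega>)))"
    unfolding occupation_def
    by (subst integral_distr[OF jointly_measurable_clock h]) (simp add: case_prod_unfold)
  have max0: "(LINT s:{0..}|lborel. exp (- lam * s) * k (max 0 s)) = (LINT s:{0..}|lborel. exp (- lam * s) * k s)"
    for k :: "real \<Rightarrow> real"
    by (rule set_lebesgue_integral_cong) (auto simp: max_def)
  have meas1: "(\<lambda>s. h (X (max 0 s) \<omega>)) \<in> borel_measurable borel" if "\<omega> \<in> space M" for \<omega>
    using measurable_compose[OF measurable_Pair1'[OF that] meas] by simp
  show "(LINT y|occupation. h y) = lam * (LINT \<omega>|M. (LINT s:{0..}|lborel. exp (- lam * s) * h (X s \<omega>)))"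
  proof -
    have "(LINT y|occupation. h y) = (LINT \<omega>|M. LINT s|clock. h (X (max 0 s) \<omega>))"
      unfolding push using P.integral_fst'[OF int] by simp
    also have "\<dots> = (LINT \<omega>|M. lam * (LINT s:{0..}|lborel. exp (- lam * s) * h (X (max 0 s) \<omega>)))"
      by (intro Bochner_Integration.integral_cong integral_clock meas1 refl)
    finally show ?thesis using max0[of "\<lambda>s. h (X s _)"] by simp
  qed
  show "(LINT y|occupation. h y) = lam * (LINT s:{0..}|lborel. exp (- lam * s) * (LINT \<omega>|M. h (X s \<omega>)))"
  proof -
    have "(LINT y|occupation. h y) = (LINT s|clock. LINT \<omega>|M. h (X (max 0 s) \<omega>))"
      unfolding push using P.integral_snd[of "\<lambda>\<omega> s. h (X (max 0 s) \<omega>)"] int by simp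
    also have "\<dots> = lam * (LINT s:{0..}|lborel. exp (- lam * s) * (LINT \<omega>|M. h (X (max 0 s) \<omega>)))"
    proof (rule integral_clock)
      show "(\<lambda>s. LINT \<omega>|M. h (X (max 0 s) \<omega>)) \<in> borel_measurable borel"
      proof (rule borel_measurable_lebesgue_integral)
        show "(\<lambda>(s, \<omega>). h (X (max 0 s) \<omega>)) \<in> borel_measurable (borel \<Otimes>\<^sub>M M)"
          using measurable_compose[OF measurable_pair_swap' meas]
          by (simp add: case_prod_beta)
      qed
    qed
    finally show ?thesis using max0[of "\<lambda>s. LINT \<omega>|M. h (X s \<omega>)"] by simp
  qed
qed

lemma
  fixes h :: "'a \<Rightarrow> real"
  assumes h: "set_borel_measurable borel S h" and bound: "\<And>y. y \<in> S \<Longrightarrow> \<bar>h y\<bar> \<le> C"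
  shows occupation_set_integral_paths:
      "(LINT y:S|occupation. h y) = lam * (LINT \<omega>|M. (LINT s:{0..}|lborel. exp (- lam * s) * h (X s \<omega>)))"
    and occupation_set_integral_marginals:
      "(LINT y:S|occupation. h y) = lam * (LINT s:{0..}|lborel. exp (- lam * s) * (LINT \<omega>|M. h (X s \<omega>)))"
    and set_integrable_occupation: "set_integrable occupation S h"
    and set_integral_occupation_bound: "\<bar>LINT y:S|occupation. h y\<bar> \<le> \<bar>C\<bar>"
proof -
  interpret occ: prob_space occupation by (rule prob_space_occupation)
  let ?h = "\<lambda>y. indicator S y *\<^sub>R h y"
  have h': "?h \<in> borel_measurable borel" using h by (simp add: set_borel_measurable_def)
  have bound': "\<bar>?h y\<bar> \<le> \<bar>C\<bar>" for y
    using bound[of y] by (auto simp: indicator_def)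
  have S_eq: "?h (X s \<omega>) = h (X s \<omega>)" if "0 \<le> s" "\<omega> \<in> space M" for s \<omega>
    using X_in[OF that] by simp
  show "(LINT y:S|occupation. h y) = lam * (LINT \<omega>|M. (LINT s:{0..}|lborel. exp (- lam * s) * h (X s \<omega>)))"
    unfolding set_lebesgue_integral_def[of occupation] occupation_integral_paths[OF h' bound']
    by (intro arg_cong[where f = "\<lambda>z. lam * z"] Bochner_Integration.integral_cong
        set_lebesgue_integral_cong) (use S_eq in auto)
  show "(LINT y:S|occupation. h y) = lam * (LINT s:{0..}|lborel. exp (- lam * s) * (LINT \<omega>|M. h (X s \<omega>)))"
    unfolding set_lebesgue_integral_def[of occupation] occupation_integral_marginals[OF h' bound']
    by (intro arg_cong[where f = "\<lambda>z. lam * z"] set_lebesgue_integral_cong allI impI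
        arg_cong2[where f = "(*)"] Bochner_Integration.integral_cong) (use S_eq in auto)
  show int: "set_integrable occupation S h"
    unfolding set_integrable_def
    by (rule occ.integrable_const_bound[where B = "\<bar>C\<bar>"])
      (use bound' h' in \<open>auto cong: measurable_cong_sets\<close>)
  have "\<bar>LINT y:S|occupation. h y\<bar> \<le> (LINT y|occupation. \<bar>?h y\<bar>)"
    unfolding set_lebesgue_integral_def by (rule integral_abs_bound)
  also have "\<dots> \<le> (LINT y|occupation. \<bar>C\<bar>)"
    using int bound' unfolding set_integrable_def
    by (intro integral_mono) auto
  finally show "\<bar>LINT y:S|occupation. h y\<bar> \<le> \<bar>C\<bar>" by (simp add: occ.prob_space)
qed

lemma
  fixes h :: "'a \<Rightarrow> real"
  assumes "continuous_on S h"
  shows set_borel_measurable_S: "set_borel_measurable borel S h"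
    and bounded_on_S: "\<exists>C. \<forall>y\<in>S. \<bar>h y\<bar> \<le> C"
proof -
  show "set_borel_measurable borel S h"
    unfolding set_borel_measurable_def using compact_S assms
    by (intro borel_measurable_continuous_on_indicator) (auto simp: borel_compact)
  have "bounded (h ` S)" using assms compact_S by (intro compact_imp_bounded compact_continuous_image)
  then show "\<exists>C. \<forall>y\<in>S. \<bar>h y\<bar> \<le> C" by (auto simp: bounded_iff)
qed

lemma measurable_of_path:
  fixes h :: "'a \<Rightarrow> real"
  assumes h: "set_borel_measurable borel S h" and t: "0 \<le> t"
  shows "(\<lambda>\<omega>. h (X t \<omega>)) \<in> borel_measurable M"
proof -
  have "(\<lambda>\<omega>. indicator S (X t \<omega>) *\<^sub>R h (X t \<omega>)) \<in> borel_measurable M"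
    using measurable_compose[OF X_measurable[OF t]] h unfolding set_borel_measurable_def by auto
  then show ?thesis
    by (rule measurable_cong[THEN iffD1, rotated]) (use X_in t in auto)
qed

lemma integrable_of_path:
  fixes h :: "'a \<Rightarrow> real"
  assumes h: "continuous_on S h" and t: "0 \<le> t"
  shows "integrable M (\<lambda>\<omega>. h (X t \<omega>))"
proof -
  obtain C where C: "\<forall>y\<in>S. \<bar>h y\<bar> \<le> C" using bounded_on_S[OF h] by blast
  show ?thesis
    by (rule integrable_const_bound[where B = C])
      (use C X_in t measurable_of_path[OF set_borel_measurable_S[OF h] t] in auto)
qed

lemma continuous_on_marginal:
  fixes f :: "'a \<Rightarrow> real"
  assumes f: "continuous_on S f"
  shows "continuous_on {0..} (\<lambda>t. LINT \<omega>|M. f (X t \<omega>))"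
proof (rule continuous_on_sequentiallyI)
  fix u :: "nat \<Rightarrow> real" and t
  assume u: "\<forall>n. u n \<in> {0..}" "t \<in> {0..}" "u \<longlonglongrightarrow> t"
  obtain C where C: "\<forall>y\<in>S. \<bar>f y\<bar> \<le> C" using bounded_on_S[OF f] by blast
  show "(\<lambda>n. LINT \<omega>|M. f (X (u n) \<omega>)) \<longlonglongrightarrow> (LINT \<omega>|M. f (X t \<omega>))"
  proof (rule integral_dominated_convergence[where w = "\<lambda>_. C"])
    show "AE \<omega> in M. (\<lambda>n. f (X (u n) \<omega>)) \<longlonglongrightarrow> f (X t \<omega>)"
    proof (rule AE_I2)
      fix \<omega> assume \<omega>: "\<omega> \<in> space M"
      have "(\<lambda>n. X (u n) \<omega>) \<longlonglongrightarrow> X t \<omega>"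
        using u by (intro continuous_on_tendsto_compose[OF X_continuous[OF \<omega>]]) auto
      then show "(\<lambda>n. f (X (u n) \<omega>)) \<longlonglongrightarrow> f (X t \<omega>)"
        using u X_in[OF _ \<omega>] by (intro continuous_on_tendsto_compose[OF f]) auto
    qed
  qed (use u C X_in measurable_of_path[OF set_borel_measurable_S[OF f]] in auto)
qed

section \<open>The resolvent identity\<close>

lemma set_integrable_exp_bounded:
  fixes m :: "real \<Rightarrow> real"
  assumes m: "continuous_on {0..} m" and bound: "\<And>r. 0 \<le> r \<Longrightarrow> \<bar>m r\<bar> \<le> C"
  shows "set_integrable lborel {0..} (\<lambda>r. exp (- lam * r) * m r)"
proof (rule set_integrable_bound)
  interpret clock: prob_space clock by (rule prob_space_clock)
  have "integrable clock (\<lambda>_. 1::real)" by simp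
  then have "integrable lborel (\<lambda>r. exponential_density lam r)"
    using lam_pos by (subst (asm) integrable_density) (auto simp: exponential_density_nonneg)
  then have "integrable lborel (\<lambda>r. (C / lam) * exponential_density lam r)"
    by (rule integrable_mult_right)
  then show "set_integrable lborel {0..} (\<lambda>r. C * exp (- lam * r))"
    unfolding set_integrable_def
    by (rule Bochner_Integration.integrable_cong[THEN iffD1, rotated -1])
      (use lam_pos in \<open>auto simp: exponential_density_def indicator_def mult_ac\<close>)
  show "set_borel_measurable lborel {0..} (\<lambda>r. exp (- lam * r) * m r)"
    unfolding set_borel_measurable_def using m
    by (simp, intro borel_measurable_continuous_on_indicator[where 'b = real, simplified])
       (auto intro!: continuous_intros)
  show "AE r in lborel. r \<in> {0..} \<longrightarrow> norm (exp (- lam * r) * m r) \<le> norm (C * exp (- lam * r))"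
  proof (intro AE_I2 impI)
    fix r :: real assume "r \<in> {0..}"
    then have "\<bar>m r\<bar> \<le> \<bar>C\<bar>" using bound[of r] by auto
    then show "norm (exp (- lam * r) * m r) \<le> norm (C * exp (- lam * r))"
      by (simp add: abs_mult mult_right_mono)
  qed
qed

text \<open>
  Shifting the time by \<open>h\<close> in the discounted integral gives
  \<open>exp (lam h) \<integral>\<^sub>h\<^sup>\<infinity> exp (- lam r) m r dr\<close>, which the fundamental theorem of calculus differentiates
  at \<open>h = 0\<close>.
\<close>

lemma discounted_shift_derivative:
  fixes m :: "real \<Rightarrow> real"
  assumes m: "continuous_on {0..} m" and bound: "\<And>r. 0 \<le> r \<Longrightarrow> \<bar>m r\<bar> \<le> C"
  shows "((\<lambda>h. ((LINT s:{0..}|lborel. exp (- lam * s) * m (s + h))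
               - (LINT s:{0..}|lborel. exp (- lam * s) * m s)) / h)
           \<longlongrightarrow> lam * (LINT s:{0..}|lborel. exp (- lam * s) * m s) - m 0) (at_right 0)"
proof -
  define F where "F r = exp (- lam * r) * m r" for r
  define \<Psi> where "\<Psi> = (LINT s:{0..}|lborel. F s)"
  define \<Phi> where "\<Phi> h = exp (lam * h) * (\<Psi> - integral {0..h} F)" for h
  have F_cont: "continuous_on {0..} F"
    unfolding F_def using m by (intro continuous_intros)
  have F_int: "set_integrable lborel {0..} F"
    unfolding F_def using m bound by (rule set_integrable_exp_bounded)
  have shift: "(LINT s:{0..}|lborel. exp (- lam * s) * m (s + h)) = \<Phi> h" if h: "0 \<le> h" for h
  proof -
    have split: "\<Psi> = (LINT r:{0..<h}|lborel. F r) + (LINT r:{h..}|lborel. F r)"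
      unfolding \<Psi>_def
      by (subst set_integral_Un[symmetric])
         (use h in \<open>auto intro!: set_integrable_subset[OF F_int] simp: ivl_disj_un\<close>)
    have "(LINT r:{0..<h}|lborel. F r) = integral {0..<h} F"
      by (rule set_borel_integral_eq_integral) (auto intro!: set_integrable_subset[OF F_int])
    also have "\<dots> = integral {0..h} F"
      by (rule integral_spike_set; rule negligible_subset[of "{h}"]) auto
    finally have head: "(LINT r:{h..}|lborel. F r) = \<Psi> - integral {0..h} F"
      using split by simp
    have "(LINT r:{h..}|lborel. F r) = (LINT s|lborel. indicator {h..} (h + s) * F (h + s))"
      unfolding set_lebesgue_integral_def
      by (subst lborel_integral_real_affine[where c = 1 and t = h]) simp_all
    also have "\<dots> = (LINT s|lborel. exp (- lam * h) * (indicator {0..} s * (exp (- lam * s) * m (s + h))))"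
      by (intro Bochner_Integration.integral_cong)
         (auto simp: F_def indicator_def exp_add[symmetric] algebra_simps)
    also have "\<dots> = exp (- lam * h) * (LINT s:{0..}|lborel. exp (- lam * s) * m (s + h))"
      by (simp add: set_lebesgue_integral_def)
    finally show ?thesis
      by (simp add: head \<Phi>_def exp_minus field_simps)
  qed
  have "((\<lambda>h. integral {0..h} F) has_real_derivative F 0) (at 0 within {0..1})"
    by (rule integral_has_real_derivative) (auto intro: continuous_on_subset[OF F_cont])
  then have "(\<Phi> has_real_derivative lam * \<Psi> - m 0) (at 0 within {0..1})"
    unfolding \<Phi>_def by (auto intro!: derivative_eq_intros simp: F_def)
  then have "((\<lambda>h. (\<Phi> h - \<Phi> 0) / h) \<longlongrightarrow> lam * \<Psi> - m 0) (at_right 0)"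
    by (simp add: has_field_derivative_iff at_within_Icc_at_right)
  moreover have "\<forall>\<^sub>F h in at_right 0. (\<Phi> h - \<Phi> 0) / h
      = ((LINT s:{0..}|lborel. exp (- lam * s) * m (s + h))
               - (LINT s:{0..}|lborel. exp (- lam * s) * m s)) / h"
    using shift[of 0] shift by (auto simp: eventually_at_filter)
  ultimately show ?thesis
    unfolding \<Psi>_def F_def by (rule Lim_transform_eventually)
qed

text \<open>
  This is \<open>R (lam f - G f) = f\<close> for the resolvent \<open>R\<close>. By the Markov property, replacing \<open>f\<close> by
  \<open>T h f\<close> shifts the marginals by \<open>h\<close>; so the difference quotients \<open>(T h f - f) / h\<close> have
  integrals that converge by the previous lemma, and also by their uniform convergence to \<open>g\<close>.
  Comparing the two limits avoids differentiating \<open>T t f\<close> at positive times.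
\<close>

lemma generator_occupation:
  fixes f g :: "'a \<Rightarrow> real" and T :: "real \<Rightarrow> ('a \<Rightarrow> real) \<Rightarrow> 'a \<Rightarrow> real"
  assumes f: "continuous_on S f" and g: "continuous_on S g"
    and T_cont: "\<And>h. 0 \<le> h \<Longrightarrow> continuous_on S (T h f)"
    and markov: "\<And>s h. 0 \<le> s \<Longrightarrow> 0 \<le> h \<Longrightarrow>
          (LINT \<omega>|M. f (X (s + h) \<omega>)) = (LINT \<omega>|M. T h f (X s \<omega>))"
    and gen: "uniform_limit S (\<lambda>t y. (T t f y - f y) / t) g (at_right 0)"
    and start: "AE \<omega> in M. X 0 \<omega> = x"
  shows "(LINT y:S|occupation. lam * f y - g y) = lam * f x"
proof -
  define m where "m t = (LINT \<omega>|M. f (X t \<omega>))" for t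
  let ?U = "\<lambda>h. LINT y:S|occupation. h y"
  let ?L = "\<lambda>m :: real \<Rightarrow> real. LINT s:{0..}|lborel. exp (- lam * s) * m s"
  have marginals: "?U k = lam * ?L (\<lambda>s. LINT \<omega>|M. k (X s \<omega>))" if "continuous_on S k" for k :: "'a \<Rightarrow> real"
    using bounded_on_S[OF that] occupation_set_integral_marginals[OF set_borel_measurable_S[OF that]]
    by blast
  have int: "set_integrable occupation S k" if "continuous_on S k" for k :: "'a \<Rightarrow> real"
    using bounded_on_S[OF that] set_integrable_occupation[OF set_borel_measurable_S[OF that]]
    by blast
  obtain C where C: "\<forall>y\<in>S. \<bar>f y\<bar> \<le> C" using bounded_on_S[OF f] by blast
  have m_bound: "\<bar>m r\<bar> \<le> C" if r: "0 \<le> r" for r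
  proof -
    have "\<bar>m r\<bar> \<le> (LINT \<omega>|M. \<bar>f (X r \<omega>)\<bar>)" unfolding m_def by (rule integral_abs_bound)
    also have "\<dots> \<le> (LINT \<omega>|M. C)"
      using integrable_of_path[OF f r] C X_in[OF r] by (intro integral_mono) auto
    finally show ?thesis by (simp add: prob_space)
  qed
  have m0: "m 0 = f x"
  proof -
    have "m 0 = (LINT \<omega>|M. f x)" unfolding m_def
      using start measurable_of_path[OF set_borel_measurable_S[OF f]]
      by (intro integral_cong_AE) auto
    then show ?thesis by (simp add: prob_space)
  qed
  \<comment> \<open>First computation of the limit: shift of the marginals.\<close>
  have "((\<lambda>h. (?L (\<lambda>s. m (s + h)) - ?L m) / h) \<longlongrightarrow> lam * ?L m - m 0) (at_right 0)"
    unfolding m_def by (rule discounted_shift_derivative)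
      (use continuous_on_marginal[OF f] m_bound in \<open>auto simp: m_def\<close>)
  then have "((\<lambda>h. lam * ((?L (\<lambda>s. m (s + h)) - ?L m) / h)) \<longlongrightarrow> lam * (lam * ?L m - m 0)) (at_right 0)"
    by (rule tendsto_mult_left)
  moreover have "\<forall>\<^sub>F h in at_right 0. lam * ((?L (\<lambda>s. m (s + h)) - ?L m) / h)
      = ?U (\<lambda>y. (T h f y - f y) / h)"
  proof (rule eventually_at_rightI[of 0 1])
    fix h :: real assume "h \<in> {0<..<1}"
    then have h: "0 < h" by simp
    have "?U (T h f) = lam * ?L (\<lambda>s. LINT \<omega>|M. T h f (X s \<omega>))"
      using marginals[OF T_cont] h by simp
    also have "?L (\<lambda>s. LINT \<omega>|M. T h f (X s \<omega>)) = ?L (\<lambda>s. m (s + h))"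
      unfolding m_def using h by (intro set_lebesgue_integral_cong) (auto simp: markov)
    finally have "?U (T h f) = lam * ?L (\<lambda>s. m (s + h))" .
    moreover have "?U f = lam * ?L m" using marginals[OF f] by (simp add: m_def)
    moreover have "?U (\<lambda>y. (T h f y - f y) / h) = (?U (T h f) - ?U f) / h"
      using int[OF T_cont] int[OF f] h by (simp add: set_integral_diff)
    ultimately show "lam * ((?L (\<lambda>s. m (s + h)) - ?L m) / h) = ?U (\<lambda>y. (T h f y - f y) / h)"
      by (simp only: right_diff_distrib times_divide_eq_right)
  qed simp
  ultimately have lim1: "((\<lambda>h. ?U (\<lambda>y. (T h f y - f y) / h)) \<longlongrightarrow> lam * (lam * ?L m - m 0)) (at_right 0)"
    by (rule Lim_transform_eventually)
  \<comment> \<open>Second computation of the limit: uniform convergence of the difference quotients.\<close>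
  have lim2: "((\<lambda>h. ?U (\<lambda>y. (T h f y - f y) / h)) \<longlongrightarrow> ?U g) (at_right 0)"
  proof (rule tendstoI)
    fix e :: real assume e: "0 < e"
    have "\<forall>\<^sub>F h in at_right 0. \<forall>y\<in>S. dist ((T h f y - f y) / h) (g y) < e / 2"
      using gen e by (intro uniform_limitD) auto
    moreover have "\<forall>\<^sub>F h in at_right 0. (0::real) < h"
      by (simp add: eventually_at_filter)
    ultimately show "\<forall>\<^sub>F h in at_right 0. dist (?U (\<lambda>y. (T h f y - f y) / h)) (?U g) < e"
    proof eventually_elim
      case (elim h)
      let ?q = "\<lambda>y. (T h f y - f y) / h"
      have q: "continuous_on S ?q"
        using T_cont[of h] f elim by (intro continuous_intros) auto
      have "?U ?q - ?U g = ?U (\<lambda>y. ?q y - g y)"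
        by (rule set_integral_diff(2)[symmetric]) (intro int q g)+
      also have "\<bar>\<dots>\<bar> \<le> \<bar>e / 2\<bar>"
        using elim(1)
        by (intro set_integral_occupation_bound set_borel_measurable_S continuous_on_diff q g)
           (auto simp: dist_real_def less_imp_le)
      finally show ?case using e by (simp add: dist_real_def)
    qed
  qed
  have "?U g = lam * (lam * ?L m - m 0)"
    using tendsto_unique[OF _ lim2 lim1] by simp
  also have "lam * ?L m = ?U f" using marginals[OF f] by (simp add: m_def)
  finally show ?thesis
    using int[OF f] int[OF g] by (simp add: set_integral_diff m0 right_diff_distrib)
qed

end

text \<open>
  The Markov property enters only through expectations of the conditional expectations.
\<close>

lemma expectation_eq_of_cond_exp_eq:
  assumes sp: "prob_space M"
    and meas: "\<And>t. 0 \<le> t \<Longrightarrow> X t \<in> borel_measurable M" and st: "0 \<le> s" 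
    and int: "integrable M \<phi>" and k: "k \<in> borel_measurable M"
    and AE: "AE \<omega> in M. real_cond_exp M (natural_filtration M X s) \<phi> \<omega> = k \<omega>"
  shows "(LINT \<omega>|M. \<phi> \<omega>) = (LINT \<omega>|M. k \<omega>)"
proof -
  interpret prob_space M by (rule sp)
  have sub: "{X r -` B \<inter> space M | r B. 0 \<le> r \<and> r \<le> s \<and> B \<in> sets borel} \<subseteq> sets M"
    using meas by (auto intro: measurable_sets)
  have "sets (natural_filtration M X s)
      = sigma_sets (space M) {X r -` B \<inter> space M | r B. 0 \<le> r \<and> r \<le> s \<and> B \<in> sets borel}"
    unfolding natural_filtration_def by (rule sets_measure_of) auto
  then have "subalgebra M (natural_filtration M X s)"
    using sets.sigma_sets_subset[OF sub]
    by (simp add: subalgebra_def natural_filtration_def space_measure_of_conv)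
  then interpret finite_measure_subalgebra M "natural_filtration M X s"
    by unfold_locales
  have "(LINT \<omega>|M. \<phi> \<omega>) = (LINT \<omega>|M. real_cond_exp M (natural_filtration M X s) \<phi> \<omega>)"
    using int by (rule real_cond_exp_int(2)[symmetric])
  also have "\<dots> = (LINT \<omega>|M. k \<omega>)"
    using AE k borel_measurable_cond_exp2 by (intro integral_cong_AE) auto
  finally show ?thesis .
qed

lemma feller_process_occupation:
  assumes FP: "feller_process M X S G x" and S: "compact S" and lam: "0 < lam"
  shows "continuous_process M X S lam"
    and "(f, g) \<in> G \<Longrightarrow>
      (LINT y:S|continuous_process.occupation M X lam. lam * f y - g y) = lam * f x"
proof -
  note FP' = FP[unfolded feller_process_def]
  have sp: "prob_space M" by (rule FP'[THEN conjunct1])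
  have meas: "X t \<in> borel_measurable M" if "0 \<le> t" for t
    by (rule FP'[THEN conjunct2, THEN conjunct1, rule_format, OF that])
  have X_in: "X t \<omega> \<in> S" if "0 \<le> t" "\<omega> \<in> space M" for t \<omega>
    by (rule FP'[THEN conjunct2, THEN conjunct2, THEN conjunct1, rule_format, OF that])
  have X_cont: "continuous_on {0..} (\<lambda>t. X t \<omega>)" if "\<omega> \<in> space M" for \<omega>
    by (rule FP'[THEN conjunct2, THEN conjunct2, THEN conjunct2, THEN conjunct1, rule_format, OF that])
  have start: "distr M borel (X 0) = return borel x"
    by (rule FP'[THEN conjunct2, THEN conjunct2, THEN conjunct2, THEN conjunct2, THEN conjunct1])
  from FP' obtain T where T: "feller_semigroup S T" "infinitesimal_generator S T = G"
     and markov: "\<forall>s\<ge>0. \<forall>t\<ge>0. \<forall>f. continuous_on S f \<longrightarrow>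
           (AE \<omega> in M. real_cond_exp M (natural_filtration M X s) (\<lambda>\<omega>'. f (X (s + t) \<omega>')) \<omega>
                        = T t f (X s \<omega>))"
    by (elim conjE exE) (rule that)
  interpret prob_space M by (rule sp)
  show proc: "continuous_process M X S lam"
    by (intro_locales; unfold_locales) (fact S lam meas X_in X_cont)+
  interpret continuous_process M X S lam by (rule proc)
  have start': "AE \<omega> in M. X 0 \<omega> = x"
  proof -
    have "AE y in distr M borel (X 0). y = x"
      unfolding start by (subst AE_return) auto
    then show ?thesis by (subst (asm) AE_distr_iff) (auto simp: meas)
  qed
  assume fg: "(f, g) \<in> G"
  then have f: "continuous_on S f" and g: "continuous_on S g"
    and gen: "uniform_limit S (\<lambda>t y. (T t f y - f y) / t) g (at_right 0)"
    using T(2) unfolding infinitesimal_generator_def by auto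
  have Tc: "continuous_on S (T h f)" if "0 \<le> h" for h
    by (rule T(1)[unfolded feller_semigroup_def, THEN conjunct1, rule_format, OF that f])
  show "(LINT y:S|occupation. lam * f y - g y) = lam * f x"
  proof (rule generator_occupation[where T = T, OF f g Tc _ gen start'])
    fix s h :: real assume sh: "0 \<le> s" "0 \<le> h"
    show "(LINT \<omega>|M. f (X (s + h) \<omega>)) = (LINT \<omega>|M. T h f (X s \<omega>))"
      by (rule expectation_eq_of_cond_exp_eq[OF sp meas sh(1)
            integrable_of_path[OF f] measurable_of_path[OF set_borel_measurable_S[OF Tc]]
            markov[rule_format, OF sh f]])
        (use sh in auto)
  qed
qed

section \<open>Geometry of a network\<close>

context
  fixes N :: "('a::euclidean_space, 'e, 'z) network_scheme"
  assumes net: "is_network N"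
begin

lemma edge_endpoints_in_verts:
  assumes "\<alpha> \<in> edges N" shows "source N \<alpha> \<in> verts N" "target N \<alpha> \<in> verts N"
  using net assms unfolding is_network_def adjacent_def by blast+

lemma len_pos: "\<alpha> \<in> edges N \<Longrightarrow> 0 < len N \<alpha>"
  using net unfolding is_network_def adjacent_def len_def by (metis zero_less_dist_iff)

lemma finite_verts: "finite (verts N)" and finite_edges: "finite (edges N)"
  using net unfolding is_network_def by blast+

lemma param_0 [simp]: "param N \<alpha> 0 = source N \<alpha>"
  by (simp add: param_def)

lemma param_len: "\<alpha> \<in> edges N \<Longrightarrow> param N \<alpha> (len N \<alpha>) = target N \<alpha>"
  using len_pos[of \<alpha>] by (simp add: param_def)

lemma dist_param:
  assumes "\<alpha> \<in> edges N" "s \<in> {0..len N \<alpha>}"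
  shows "dist (source N \<alpha>) (param N \<alpha> s) = s"
  using assms len_pos[of \<alpha>]
  by (simp add: param_def dist_norm norm_minus_commute len_def)

lemma param_in_seg:
  assumes "\<alpha> \<in> edges N" "s \<in> {0..len N \<alpha>}"
  shows "param N \<alpha> s \<in> seg N \<alpha>"
proof -
  have "param N \<alpha> s = (1 - s / len N \<alpha>) *\<^sub>R source N \<alpha> + (s / len N \<alpha>) *\<^sub>R target N \<alpha>"
    by (simp add: param_def algebra_simps divide_inverse)
  then show ?thesis
    using assms len_pos[of \<alpha>] unfolding seg_def in_segment
    by (intro exI[of _ "s / len N \<alpha>"]) simp
qed

lemma seg_param:
  assumes \<alpha>: "\<alpha> \<in> edges N" and x: "x \<in> seg N \<alpha>"
  shows "dist (source N \<alpha>) x \<in> {0..len N \<alpha>}" "param N \<alpha> (dist (source N \<alpha>) x) = x"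
proof -
  from x obtain r where r: "0 \<le> r" "r \<le> 1" "x = (1 - r) *\<^sub>R source N \<alpha> + r *\<^sub>R target N \<alpha>"
    unfolding seg_def in_segment by blast
  have "x = param N \<alpha> (r * len N \<alpha>)"
    using len_pos[OF \<alpha>] r(3) by (simp add: param_def algebra_simps)
  moreover have "r * len N \<alpha> \<in> {0..len N \<alpha>}"
    using r len_pos[OF \<alpha>] by (simp add: mult_left_le_one_le)
  ultimately show "dist (source N \<alpha>) x \<in> {0..len N \<alpha>}" "param N \<alpha> (dist (source N \<alpha>) x) = x"
    using dist_param[OF \<alpha>] by simp_all
qed

lemma edge_vertex:
  assumes "\<alpha> \<in> edges N" "v \<in> verts N" "v \<in> seg N \<alpha>"
  shows "v = source N \<alpha> \<or> v = target N \<alpha>"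
  using net assms unfolding is_network_def by blast

lemma param_interior:
  assumes \<alpha>: "\<alpha> \<in> edges N" and s: "s \<in> {0<..<len N \<alpha>}"
  shows "param N \<alpha> s \<in> seg N \<alpha> - verts N"
proof -
  have "param N \<alpha> s \<in> seg N \<alpha>" using param_in_seg[OF \<alpha>] s by simp
  moreover have "param N \<alpha> s \<noteq> source N \<alpha>" "param N \<alpha> s \<noteq> target N \<alpha>"
    using dist_param[OF \<alpha>, of s] s by (auto simp: len_def)
  ultimately show ?thesis using edge_vertex[OF \<alpha>] by blast
qed

lemma interior_param:
  assumes \<alpha>: "\<alpha> \<in> edges N" and x: "x \<in> seg N \<alpha> - verts N"
  shows "dist (source N \<alpha>) x \<in> {0<..<len N \<alpha>}"
proof -
  have "x \<noteq> source N \<alpha>" "x \<noteq> target N \<alpha>" using edge_endpoints_in_verts[OF \<alpha>] x by auto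
  then have "dist (source N \<alpha>) x \<noteq> 0" "dist (source N \<alpha>) x \<noteq> len N \<alpha>"
    using seg_param(2)[OF \<alpha>, of x] x param_len[OF \<alpha>] by auto
  then show ?thesis using seg_param(1)[OF \<alpha>, of x] x by auto
qed

text \<open>
  Two different edges meet at most in vertices, so a point off the vertices determines its edge.
\<close>

lemma edge_unique:
  assumes "\<alpha> \<in> edges N" "\<beta> \<in> edges N" "x \<in> seg N \<alpha>" "x \<in> seg N \<beta>" "x \<notin> verts N"
  shows "\<alpha> = \<beta>"
proof (rule ccontr)
  assume "\<alpha> \<noteq> \<beta>"
  then have *: "(\<forall>v\<in>verts N. v \<in> seg N \<alpha> \<and> v \<in> seg N \<beta> \<longrightarrow> seg N \<alpha> \<inter> seg N \<beta> = {v}) \<and>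
        ((\<forall>v\<in>verts N. \<not> (v \<in> seg N \<alpha> \<and> v \<in> seg N \<beta>)) \<longrightarrow> seg N \<alpha> \<inter> seg N \<beta> = {})"
    using net assms unfolding is_network_def by blast
  show False
  proof (cases "\<exists>v\<in>verts N. v \<in> seg N \<alpha> \<and> v \<in> seg N \<beta>")
    case True
    then obtain v where v: "v \<in> verts N" "seg N \<alpha> \<inter> seg N \<beta> = {v}" using * by blast
    have "x \<in> seg N \<alpha> \<inter> seg N \<beta>" using assms(3,4) by simp
    with v assms(5) show False by simp
  next
    case False
    with * have "seg N \<alpha> \<inter> seg N \<beta> = {}" by simp
    with assms(3,4) show False by blast
  qed
qed

lemma vertex_in_net_set: 
  assumes "v \<in> verts N" shows "v \<in> net_set N"
proof -
  obtain w where "adjacent N v w" using net assms unfolding is_network_def by blast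
  then obtain p where p: "p \<in> pairs N" "v = fst p \<or> v = snd p"
    unfolding adjacent_def by force
  have "\<forall>(v, w)\<in>pairs N. \<exists>\<alpha>\<in>edges N. seg N \<alpha> = closed_segment v w"
    using net unfolding is_network_def by blast
  then obtain \<alpha> where "\<alpha> \<in> edges N" "seg N \<alpha> = closed_segment (fst p) (snd p)"
    using p(1) by (cases p) fastforce
  then show ?thesis using p(2) unfolding net_set_def by auto
qed

lemma net_set_cases:
  assumes "x \<in> net_set N"
  obtains (vertex) "x \<in> verts N" 
    | (interior) \<alpha> s where "\<alpha> \<in> edges N" "s \<in> {0<..<len N \<alpha>}" "x = param N \<alpha> s" "x \<notin> verts N"
proof (cases "x \<in> verts N")
  case False
  then obtain \<alpha> where "\<alpha> \<in> edges N" "x \<in> seg N \<alpha>" using assms unfolding net_set_def by blast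
  show ?thesis
    by (rule interior[OF \<open>\<alpha> \<in> edges N\<close> interior_param[OF \<open>\<alpha> \<in> edges N\<close>, of x]])
      (use seg_param(2)[OF \<open>\<alpha> \<in> edges N\<close>, of x] \<open>x \<in> seg N \<alpha>\<close> False in auto)
qed (rule vertex)

lemma compact_net_set: "compact (net_set N)"
  unfolding net_set_def seg_def using finite_edges by (intro compact_UN) auto

lemma continuous_on_param: "continuous_on A (param N \<alpha>)"
  unfolding param_def by (intro continuous_intros)

lemma seg_subset_net: "\<alpha> \<in> edges N \<Longrightarrow> seg N \<alpha> \<subseteq> net_set N"
  unfolding net_set_def by blast

lemma continuous_on_net:
  assumes "\<And>\<alpha>. \<alpha> \<in> edges N \<Longrightarrow> continuous_on {0..len N \<alpha>} (on_edge N \<alpha> h)"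
  shows "continuous_on (net_set N) h"
  unfolding net_set_def
proof (rule continuous_on_closed_Union)
  fix \<alpha> assume \<alpha>: "\<alpha> \<in> edges N"
  show "closed (seg N \<alpha>)" by (simp add: seg_def)
  have "continuous_on (seg N \<alpha>) (\<lambda>x. on_edge N \<alpha> h (dist (source N \<alpha>) x))"
    using seg_param(1)[OF \<alpha>]
    by (intro continuous_on_compose2[OF assms[OF \<alpha>]] continuous_intros) auto
  then show "continuous_on (seg N \<alpha>) h"
    by (rule continuous_on_cong[THEN iffD1, rotated -1])
      (auto simp: on_edge_def seg_param(2)[OF \<alpha>])
qed (rule finite_edges)

text \<open>
  A function on the network from values \<open>c\<close> at the vertices and functions \<open>h \<alpha>\<close> of the arc length
  on the edges. At the vertices the data \<open>c\<close> win, so that the end values of \<open>h \<alpha>\<close> may differ from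
  them; the result is continuous along an edge only if they agree.
\<close>

definition glue :: "('a \<Rightarrow> real) \<Rightarrow> ('e \<Rightarrow> real \<Rightarrow> real) \<Rightarrow> 'a \<Rightarrow> real" where
  "glue c h x = (if x \<in> verts N then c x
     else (let \<alpha> = (THE \<alpha>. \<alpha> \<in> edges N \<and> x \<in> seg N \<alpha>) in h \<alpha> (dist (source N \<alpha>) x)))"

lemma glue_vertex: "v \<in> verts N \<Longrightarrow> glue c h v = c v"
  by (simp add: glue_def)

lemma glue_interior:
  assumes \<alpha>: "\<alpha> \<in> edges N" and s: "s \<in> {0<..<len N \<alpha>}"
  shows "glue c h (param N \<alpha> s) = h \<alpha> s"
proof -
  note int = param_interior[OF \<alpha> s]
  then have "(THE \<beta>. \<beta> \<in> edges N \<and> param N \<alpha> s \<in> seg N \<beta>) = \<alpha>"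
    using \<alpha> edge_unique by blast
  with int show ?thesis using dist_param[OF \<alpha>, of s] s by (simp add: glue_def)
qed

lemma glue_param:
  assumes \<alpha>: "\<alpha> \<in> edges N" and s: "s \<in> {0..len N \<alpha>}"
    and c: "h \<alpha> 0 = c (source N \<alpha>)" "h \<alpha> (len N \<alpha>) = c (target N \<alpha>)"
  shows "glue c h (param N \<alpha> s) = h \<alpha> s"
proof (cases "s \<in> {0<..<len N \<alpha>}")
  case True
  then show ?thesis by (rule glue_interior[OF \<alpha>])
next
  case False
  then have "s = 0 \<or> s = len N \<alpha>" using s by auto
  then show ?thesis using edge_endpoints_in_verts[OF \<alpha>] c param_len[OF \<alpha>]
    by (auto simp: glue_def)
qed

end

section \<open>Derivatives along an edge\<close>

text \<open>
  The derivatives are arguments, so that the one-sided derivatives at the two ends can be computed with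
  and need not be recovered from the iterated vector derivative.
\<close>

definition C2_along :: "real \<Rightarrow> (real \<Rightarrow> real) \<Rightarrow> (real \<Rightarrow> real) \<Rightarrow> (real \<Rightarrow> real) \<Rightarrow> bool" where
  "C2_along L f f' f'' \<longleftrightarrow>
     (\<forall>s\<in>{0..L}. (f has_real_derivative f' s) (at s within {0..L})) \<and>
     (\<forall>s\<in>{0..L}. (f' has_real_derivative f'' s) (at s within {0..L})) \<and>
     continuous_on {0..L} f''"

lemma C2_along_cong:
  assumes "C2_along L f f' f''" "\<And>s. s \<in> {0..L} \<Longrightarrow> g s = f s"
  shows "C2_along L g f' f''"
  using assms unfolding C2_along_def has_field_derivative_def
  by (blast intro: has_derivative_transform)

lemma C2_along_continuous:
  assumes "C2_along L f f' f''"
  shows "continuous_on {0..L} f" "continuous_on {0..L} f'" "continuous_on {0..L} f''"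
  using assms unfolding C2_along_def
  by (auto intro: DERIV_continuous_on)

lemma C2_along_add:
  assumes "C2_along L f f' f''" "C2_along L g g' g''"
  shows "C2_along L (\<lambda>s. f s + g s) (\<lambda>s. f' s + g' s) (\<lambda>s. f'' s + g'' s)"
  using assms unfolding C2_along_def by (auto intro!: DERIV_add continuous_intros)

lemma Ck_interval_2_iff:
  "Ck_interval 2 L f \<longleftrightarrow> (\<exists>f' f''. C2_along L f f' f'')"
proof
  assume "Ck_interval 2 L f"
  then obtain D where D: "\<forall>s\<in>{0..L}. D 0 s = f s"
    "\<forall>i<2. \<forall>s\<in>{0..L}. (D i has_real_derivative D (Suc i) s) (at s within {0..L})"
    "continuous_on {0..L} (D 2)"
    unfolding Ck_interval_def by blast
  have "C2_along L (D 0) (D 1) (D 2)"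
    using D(2)[rule_format, of 0] D(2)[rule_format, of 1] D(3)
    by (auto simp: C2_along_def numeral_2_eq_2)
  then show "\<exists>f' f''. C2_along L f f' f''"
    using D(1) C2_along_cong by metis
next
  assume "\<exists>f' f''. C2_along L f f' f''"
  then obtain f' f'' where f: "C2_along L f f' f''" by blast
  let ?D = "\<lambda>i::nat. if i = 0 then f else if i = 1 then f' else f''"
  show "Ck_interval 2 L f"
    unfolding Ck_interval_def
    by (rule exI[of _ ?D]) (use f in \<open>auto simp: C2_along_def less_2_cases_iff\<close>)
qed

lemma interval_deriv_eq:
  assumes L: "0 < L" and s: "s \<in> {0..L}"
    and f: "(f has_real_derivative d) (at s within {0..L})"
    and eq: "\<And>r. r \<in> {0..L} \<Longrightarrow> g r = f r"
  shows "interval_deriv L g s = d"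
proof -
  have "(g has_real_derivative d) (at s within {0..L})"
    using f eq s unfolding has_field_derivative_def by (blast intro: has_derivative_transform)
  then show ?thesis
    unfolding interval_deriv_def using L s
    by (intro vector_derivative_within_closed_interval)
       (auto simp: has_real_derivative_iff_has_vector_derivative)
qed

context
  fixes N :: "('a::euclidean_space, 'e, 'z) network_scheme"
    and \<alpha> :: 'e and u :: "'a \<Rightarrow> real" and u' u'' :: "real \<Rightarrow> real"
  assumes net: "is_network N" and \<alpha>: "\<alpha> \<in> edges N"
    and u: "C2_along (len N \<alpha>) (on_edge N \<alpha> u) u' u''"
begin

lemma interval_deriv_1:
  "s \<in> {0..len N \<alpha>} \<Longrightarrow> interval_deriv (len N \<alpha>) (on_edge N \<alpha> u) s = u' s"
  using u len_pos[OF net \<alpha>] by (intro interval_deriv_eq) (auto simp: C2_along_def)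

lemma edge_deriv_1:
  assumes "x \<in> seg N \<alpha>"
  shows "edge_deriv 1 N \<alpha> u x = u' (dist (source N \<alpha>) x)"
  using seg_param(1)[OF net \<alpha> assms] by (simp add: edge_deriv_def interval_deriv_1)

lemma edge_deriv_2:
  assumes "x \<in> seg N \<alpha>"
  shows "edge_deriv 2 N \<alpha> u x = u'' (dist (source N \<alpha>) x)"
proof -
  have "interval_deriv (len N \<alpha>) (interval_deriv (len N \<alpha>) (on_edge N \<alpha> u)) s = u'' s"
    if s: "s \<in> {0..len N \<alpha>}" for s
    by (rule interval_deriv_eq[OF len_pos[OF net \<alpha>] s, where f = u'])
      (use u s in \<open>auto simp: C2_along_def interval_deriv_1\<close>)
  then show ?thesis
    using seg_param(1)[OF net \<alpha> assms] by (simp add: edge_deriv_def numeral_2_eq_2)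
qed

lemma outward_deriv_eq:
  "outward_deriv N \<alpha> u v = (if v = source N \<alpha> then - u' 0 else u' (len N \<alpha>))"
  using len_pos[OF net \<alpha>] by (simp add: outward_deriv_def interval_deriv_1)

end

section \<open>Piecewise continuous functions\<close>

lemma continuous_on_Icc_bounded:
  fixes h :: "real \<Rightarrow> real"
  assumes "continuous_on {0..L} h"
  shows "\<exists>C. \<forall>s\<in>{0..L}. \<bar>h s\<bar> \<le> C"
proof -
  have "bounded (h ` {0..L})"
    using assms by (intro compact_imp_bounded compact_continuous_image) auto
  then show ?thesis by (auto simp: bounded_iff)
qed

lemma continuous_extension_closed_interval:
  fixes h :: "real \<Rightarrow> real"
  assumes "0 < L" "continuous_on {0<..<L} h" "(h \<longlongrightarrow> l) (at_right 0)" "(h \<longlongrightarrow> r) (at_left L)"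
  shows "\<exists>H. continuous_on {0..L} H \<and> (\<forall>s\<in>{0<..<L}. H s = h s)"
proof (intro exI conjI ballI)
  let ?H = "\<lambda>s. if s = 0 then l else if s = L then r else h s"
  show "?H s = h s" if "s \<in> {0<..<L}" for s using that by simp
  show "continuous_on {0..L} ?H"
  proof (rule continuous_on_IccI)
    show "(?H \<longlongrightarrow> ?H 0) (at_right 0)"
      using assms(1,3) by (auto elim!: Lim_transform_eventually intro!: eventually_at_rightI[of 0 L])
    show "(?H \<longlongrightarrow> ?H L) (at_left L)"
      using assms(1,4) by (auto elim!: Lim_transform_eventually intro!: eventually_at_leftI[of 0 L])
    fix s assume s: "0 < s" "s < L"
    then have "(h \<longlongrightarrow> h s) (at s)"
      using assms(2) by (simp add: continuous_on_eq_continuous_at isCont_def)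
    moreover have "\<forall>\<^sub>F t in at s. h t = ?H t"
      using s by (intro eventually_at_in_open'[THEN eventually_mono, of "{0<..<L}"]) auto
    ultimately show "(?H \<longlongrightarrow> ?H s) (at s)"
      using s by (auto elim: Lim_transform_eventually)
  qed (rule assms(1))
qed

text \<open>
  This is how all coefficients that involve a control enter: they are continuous inside each edge, and
  their limits at the two ends depend on the edge. The values at the vertices are arbitrary.
\<close>

definition edge_extendable ::
  "('a::euclidean_space, 'e, 'z) network_scheme \<Rightarrow> 'e \<Rightarrow> ('a \<Rightarrow> real) \<Rightarrow> bool" where
  "edge_extendable N \<alpha> h \<longleftrightarrow>
     (\<exists>H. continuous_on {0..len N \<alpha>} H \<and> (\<forall>s\<in>{0<..<len N \<alpha>}. H s = on_edge N \<alpha> h s))"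

lemma edge_extendableE:
  assumes "edge_extendable N \<alpha> h"
  obtains H where "continuous_on {0..len N \<alpha>} H"
    "\<And>s. s \<in> {0<..<len N \<alpha>} \<Longrightarrow> H s = h (param N \<alpha> s)"
  using assms unfolding edge_extendable_def on_edge_def by blast

lemma PC_net_edge_extendable:
  assumes "is_network N" "h \<in> PC_net N" "\<alpha> \<in> edges N"
  shows "edge_extendable N \<alpha> h"
proof -
  from assms obtain l r where "continuous_on {0<..<len N \<alpha>} (on_edge N \<alpha> h)"
    "(on_edge N \<alpha> h \<longlongrightarrow> l) (at_right 0)" "(on_edge N \<alpha> h \<longlongrightarrow> r) (at_left (len N \<alpha>))"
    unfolding PC_net_def by blast
  then show ?thesis
    unfolding edge_extendable_def
    by (rule continuous_extension_closed_interval[OF len_pos[OF assms(1,3)]])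
qed

lemma net_uniform_bound:
  fixes h :: "'i \<Rightarrow> 'a::euclidean_space \<Rightarrow> real"
  assumes net: "is_network N"
    and vertex: "\<And>v. v \<in> verts N \<Longrightarrow> \<exists>C. \<forall>i. \<bar>h i v\<bar> \<le> C"
    and edge: "\<And>\<alpha>. \<alpha> \<in> edges N \<Longrightarrow> \<exists>C. \<forall>i. \<forall>s\<in>{0<..<len N \<alpha>}. \<bar>h i (param N \<alpha> s)\<bar> \<le> C"
  shows "\<exists>C. \<forall>i. \<forall>x\<in>net_set N. \<bar>h i x\<bar> \<le> C"
proof -
  obtain d where d: "\<And>v i. v \<in> verts N \<Longrightarrow> \<bar>h i v\<bar> \<le> d v" using vertex by metis
  obtain c where c: "\<And>\<alpha> i s. \<alpha> \<in> edges N \<Longrightarrow> s \<in> {0<..<len N \<alpha>} \<Longrightarrow> \<bar>h i (param N \<alpha> s)\<bar> \<le> c \<alpha>"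
    using edge by metis
  have "\<bar>h i x\<bar> \<le> (\<Sum>\<alpha>\<in>edges N. \<bar>c \<alpha>\<bar>) + (\<Sum>v\<in>verts N. \<bar>d v\<bar>)" if x: "x \<in> net_set N" for i x
    using net x
  proof (cases rule: net_set_cases)
    case vertex
    then have "\<bar>h i x\<bar> \<le> \<bar>d x\<bar>" using d[of x i] by simp
    also have "\<dots> \<le> (\<Sum>v\<in>verts N. \<bar>d v\<bar>)"
      using finite_verts[OF net] vertex by (intro member_le_sum) auto
    finally show ?thesis by (simp add: add_increasing sum_nonneg)
  next
    case (interior \<alpha> s)
    then have "\<bar>h i x\<bar> \<le> \<bar>c \<alpha>\<bar>" using c[of \<alpha> s i] by simp
    also have "\<dots> \<le> (\<Sum>\<alpha>\<in>edges N. \<bar>c \<alpha>\<bar>)"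
      using finite_edges[OF net] interior(1) by (intro member_le_sum) auto
    finally show ?thesis by (simp add: add_increasing2 sum_nonneg)
  qed
  then show ?thesis by blast
qed

text \<open>
  The network is a finite disjoint union of vertices and open edges, and the function is continuous on
  each of these pieces.
\<close>

lemma edge_extendable_bounded_measurable:
  assumes net: "is_network N"
    and ext: "\<And>\<alpha>. \<alpha> \<in> edges N \<Longrightarrow> edge_extendable N \<alpha> h"
  shows "set_borel_measurable borel (net_set N) h" "\<exists>C. \<forall>x\<in>net_set N. \<bar>h x\<bar> \<le> C"
proof -
  obtain H where H: "\<And>\<alpha>. \<alpha> \<in> edges N \<Longrightarrow> continuous_on {0..len N \<alpha>} (H \<alpha>)"
     "\<And>\<alpha> s. \<alpha> \<in> edges N \<Longrightarrow> s \<in> {0<..<len N \<alpha>} \<Longrightarrow> H \<alpha> s = on_edge N \<alpha> h s"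
    using ext unfolding edge_extendable_def by metis
  have meas_edge: "h \<in> borel_measurable (restrict_space borel (seg N \<alpha> - verts N))" if \<alpha>: "\<alpha> \<in> edges N" for \<alpha>
  proof (rule borel_measurable_continuous_on_restrict)
    have "continuous_on (seg N \<alpha> - verts N) (\<lambda>x. H \<alpha> (dist (source N \<alpha>) x))"
      using seg_param(1)[OF net \<alpha>]
      by (intro continuous_on_compose2[OF H(1)[OF \<alpha>]] continuous_intros) auto
    then show "continuous_on (seg N \<alpha> - verts N) h"
      by (rule continuous_on_cong[THEN iffD1, rotated -1])
         (use H(2)[OF \<alpha>] interior_param[OF net \<alpha>] seg_param(2)[OF net \<alpha>] in \<open>auto simp: on_edge_def\<close>)
  qed
  let ?C = "insert (- net_set N) ((\<lambda>v. {v}) ` verts N \<union> (\<lambda>\<alpha>. seg N \<alpha> - verts N) ` edges N)"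
  have fin: "finite ?C" using finite_verts[OF net] finite_edges[OF net] by simp
  have closed: "closed (net_set N)" "closed (seg N \<alpha>)" "closed (verts N)" for \<alpha>
    using compact_net_set[OF net] finite_verts[OF net]
    by (auto simp: compact_imp_closed seg_def finite_imp_closed)
  show "set_borel_measurable borel (net_set N) h"
    unfolding set_borel_measurable_def
  proof (rule measurable_piecewise_restrict[where C = ?C])
    show "countable ?C" using fin by (rule countable_finite)
    show "space borel \<subseteq> \<Union> ?C" unfolding net_set_def by auto
    fix \<Omega> assume \<Omega>: "\<Omega> \<in> ?C"
    have borel: "- net_set N \<in> sets borel" "seg N \<alpha> - verts N \<in> sets borel" for \<alpha>
      using closed borel_closed by (blast intro: borel_comp sets.Diff)+
    from \<Omega> show "\<Omega> \<inter> space borel \<in> sets borel"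
      using borel by auto
    from \<Omega> consider "\<Omega> = - net_set N" | v where "v \<in> verts N" "\<Omega> = {v}"
      | \<alpha> where "\<alpha> \<in> edges N" "\<Omega> = seg N \<alpha> - verts N" by blast
    then show "(\<lambda>x. indicator (net_set N) x *\<^sub>R h x) \<in> borel_measurable (restrict_space borel \<Omega>)"
    proof cases
      case 1
      then show ?thesis
        by (intro measurable_cong[THEN iffD1, OF _ measurable_const[of 0]]) (auto simp: space_restrict_space)
    next
      case 2
      then show ?thesis by (intro borel_measurable_continuous_on_restrict) simp
    next
      case 3
      then show ?thesis using seg_subset_net[OF net 3(1)]
        by (intro measurable_cong[THEN iffD2, OF _ meas_edge[OF 3(1), folded 3(2)]])
           (auto simp: space_restrict_space 3(2))
    qed
  qed
  have "\<exists>C. \<forall>i::unit. \<forall>s\<in>{0<..<len N \<alpha>}. \<bar>h (param N \<alpha> s)\<bar> \<le> C" if "\<alpha> \<in> edges N" for \<alpha>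
  proof -
    obtain C where C: "\<forall>s\<in>{0..len N \<alpha>}. \<bar>H \<alpha> s\<bar> \<le> C"
      using continuous_on_Icc_bounded[OF H(1)[OF \<open>\<alpha> \<in> edges N\<close>]] by blast
    have "\<bar>h (param N \<alpha> s)\<bar> \<le> C" if "s \<in> {0<..<len N \<alpha>}" for s
      using C[rule_format, of s] H(2)[OF \<open>\<alpha> \<in> edges N\<close> that] that by (simp add: on_edge_def)
    then show ?thesis by blast
  qed
  then show "\<exists>C. \<forall>x\<in>net_set N. \<bar>h x\<bar> \<le> C"
    using net_uniform_bound[OF net, of "\<lambda>_::unit. h"] by auto
qed

section \<open>Correctors that change only the second derivative at a vertex\<close>

text \<open>
  The function \<open>s\<^sup>2 / 2\<close> has value and slope \<open>0\<close> and second derivative \<open>1\<close> at the vertex \<open>s = 0\<close>. The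
  power of \<open>1 - s / L\<close> localises it there as \<open>n\<close> grows; the exponent starts at 3 so that value,
  slope and second derivative all vanish at the other end \<open>s = L\<close> for every \<open>n\<close>.
\<close>

definition corrector :: "real \<Rightarrow> nat \<Rightarrow> real \<Rightarrow> real" where
  "corrector L n s = s\<^sup>2 / 2 * (1 - s / L) ^ (n + 3)"

definition corrector' :: "real \<Rightarrow> nat \<Rightarrow> real \<Rightarrow> real" where
  "corrector' L n s = s * (1 - s / L) ^ (n + 3) - real (n + 3) * s\<^sup>2 / (2 * L) * (1 - s / L) ^ (n + 2)"

definition corrector'' :: "real \<Rightarrow> nat \<Rightarrow> real \<Rightarrow> real" where
  "corrector'' L n s = (1 - s / L) ^ (n + 3) - 2 * real (n + 3) * (s / L) * (1 - s / L) ^ (n + 2)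
     + real (n + 3) * real (n + 2) / 2 * (s / L)\<^sup>2 * (1 - s / L) ^ (n + 1)"

lemma Bernstein_le_1:
  assumes "0 \<le> t" "t \<le> 1"
  shows "Bernstein n k t \<le> 1"
proof (cases "k \<le> n")
  case True
  then have "Bernstein n k t \<le> (\<Sum>k\<le>n. Bernstein n k t)"
    using assms by (intro member_le_sum) (auto intro: Bernstein_nonneg)
  then show ?thesis by simp
qed (simp add: Bernstein_def binomial_eq_0)

text \<open>
  Expressed by Bernstein polynomials, which lie between 0 and 1, the correctors and their derivatives
  are visibly bounded uniformly in the index.
\<close>

lemma corrector_Bernstein:
  assumes L: "0 < L"
  shows "corrector L n s = L\<^sup>2 * ((s / L)\<^sup>2 / 2 * Bernstein (n + 3) 0 (s / L))"
    and "corrector' L n s = L * ((s / L) * Bernstein (n + 3) 0 (s / L) - (s / L) / 2 * Bernstein (n + 3) 1 (s / L))"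
    and "corrector'' L n s = Bernstein (n + 3) 0 (s / L) - 2 * Bernstein (n + 3) 1 (s / L) + Bernstein (n + 3) 2 (s / L)"
proof -
  have 2: "real ((n + 3) choose 2) = real (n + 3) * real (n + 2) / 2"
  proof -
    have "2 * ((n + 3) choose 2) = (n + 3) * (n + 2)"
      using choose_two[of "n + 3"] by simp
    then have "2 * real ((n + 3) choose 2) = real (n + 3) * real (n + 2)"
      by (metis of_nat_mult of_nat_numeral)
    then show ?thesis by simp
  qed
  show "corrector L n s = L\<^sup>2 * ((s / L)\<^sup>2 / 2 * Bernstein (n + 3) 0 (s / L))"
    using L by (simp add: corrector_def Bernstein_def power_divide)
  show "corrector' L n s = L * ((s / L) * Bernstein (n + 3) 0 (s / L) - (s / L) / 2 * Bernstein (n + 3) 1 (s / L))"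
    using L by (simp add: corrector'_def Bernstein_def power2_eq_square right_diff_distrib mult_ac)
  show "corrector'' L n s = Bernstein (n + 3) 0 (s / L) - 2 * Bernstein (n + 3) 1 (s / L) + Bernstein (n + 3) 2 (s / L)"
    unfolding corrector''_def Bernstein_def 2 by simp
qed

lemma corrector_bounds:
  assumes L: "0 < L" and s: "s \<in> {0..L}"
  shows "\<bar>corrector L n s\<bar> \<le> L\<^sup>2" "\<bar>corrector' L n s\<bar> \<le> 2 * L" "\<bar>corrector'' L n s\<bar> \<le> 4"
proof -
  define t where "t = s / L"
  have t: "0 \<le> t" "t \<le> 1" using L s by (auto simp: t_def)
  let ?B = "\<lambda>k. Bernstein (n + 3) k t"
  have B: "0 \<le> ?B k" "?B k \<le> 1" for k
    using t Bernstein_nonneg Bernstein_le_1 by blast+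
  have "t\<^sup>2 \<le> 1" using t by (simp add: power_le_one)
  then have "t\<^sup>2 / 2 * ?B 0 \<le> 1"
    using B[of 0] by (intro mult_le_one) auto
  moreover have "0 \<le> t\<^sup>2 / 2 * ?B 0" using B[of 0] by simp
  ultimately have "\<bar>t\<^sup>2 / 2 * ?B 0\<bar> \<le> 1" by linarith
  then have "L\<^sup>2 * \<bar>t\<^sup>2 / 2 * ?B 0\<bar> \<le> L\<^sup>2 * 1" by (intro mult_left_mono) auto
  then show "\<bar>corrector L n s\<bar> \<le> L\<^sup>2"
    unfolding corrector_Bernstein[OF L] t_def[symmetric] by (simp add: abs_mult)
  have "t * ?B k \<le> 1" "0 \<le> t * ?B k" for k
    using t B[of k] by (auto intro: mult_le_one)
  from this[of 0] this[of 1] have "t * ?B 0 \<le> 1" "t / 2 * ?B 1 \<le> 1" "0 \<le> t * ?B 0" "0 \<le> t / 2 * ?B 1"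
    by auto
  then have "\<bar>t * ?B 0 - t / 2 * ?B 1\<bar> \<le> 2" by linarith
  then have "L * \<bar>t * ?B 0 - t / 2 * ?B 1\<bar> \<le> L * 2" using L by (intro mult_left_mono) auto
  then show "\<bar>corrector' L n s\<bar> \<le> 2 * L"
    unfolding corrector_Bernstein[OF L] t_def[symmetric] using L by (simp add: abs_mult)
  show "\<bar>corrector'' L n s\<bar> \<le> 4"
    unfolding corrector_Bernstein[OF L] t_def[symmetric] using B[of 0] B[of 1] B[of 2] by linarith
qed

lemma corrector_endpoints:
  assumes "0 < L"
  shows "corrector L n 0 = 0" "corrector' L n 0 = 0" "corrector'' L n 0 = 1"
    "corrector L n L = 0" "corrector' L n L = 0" "corrector'' L n L = 0"
  using assms by (auto simp: corrector_def corrector'_def corrector''_def)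

lemma geometric_moments_tendsto_0:
  fixes q :: real
  assumes q: "0 \<le> q" "q < 1"
  shows "(\<lambda>n. q ^ n) \<longlonglongrightarrow> 0" "(\<lambda>n. real n * q ^ n) \<longlonglongrightarrow> 0" "(\<lambda>n. (real n)\<^sup>2 * q ^ n) \<longlonglongrightarrow> 0"
proof -
  show "(\<lambda>n. q ^ n) \<longlonglongrightarrow> 0" using q by (intro LIMSEQ_realpow_zero) auto
  show "(\<lambda>n. real n * q ^ n) \<longlonglongrightarrow> 0" using q by (intro powser_times_n_limit_0) auto
  have "(\<lambda>n. (real n * sqrt q ^ n)\<^sup>2) \<longlonglongrightarrow> 0\<^sup>2"
    using q by (intro tendsto_power powser_times_n_limit_0) auto
  moreover have "(real n * sqrt q ^ n)\<^sup>2 = (real n)\<^sup>2 * q ^ n" for n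
    using q by (simp add: power_mult_distrib flip: power_mult) (simp add: power_mult mult.commute[of n])
  ultimately show "(\<lambda>n. (real n)\<^sup>2 * q ^ n) \<longlonglongrightarrow> 0" by simp
qed

text \<open>
  Off the vertex the powers of \<open>q = 1 - s / L\<close> beat the polynomial factors; at the vertex value and
  slope vanish identically, and only the second derivative keeps the value 1.
\<close>

lemma corrector_tendsto_0:
  assumes L: "0 < L" and s: "s \<in> {0..L}"
  shows "(\<lambda>n. corrector L n s) \<longlonglongrightarrow> 0" "(\<lambda>n. corrector' L n s) \<longlonglongrightarrow> 0"
    and "s \<noteq> 0 \<Longrightarrow> (\<lambda>n. corrector'' L n s) \<longlonglongrightarrow> 0"
proof -
  define q where "q = 1 - s / L"
  note lims = geometric_moments_tendsto_0[of q]
  have q: "0 \<le> q" "q < 1" if "s \<noteq> 0" using L s that by (auto simp: q_def)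
  have 0: "corrector L n s = s\<^sup>2 / 2 * q ^ 3 * q ^ n" for n
    by (simp add: corrector_def q_def power_add)
  have 1: "corrector' L n s = s * q ^ 3 * q ^ n - s\<^sup>2 / (2 * L) * q\<^sup>2 * (real n * q ^ n + 3 * q ^ n)" for n
    unfolding corrector'_def q_def[symmetric] by (simp add: power_add power2_eq_square algebra_simps add_divide_distrib)
  have 2: "corrector'' L n s = q ^ 3 * q ^ n - 2 * (s / L) * q\<^sup>2 * (real n * q ^ n + 3 * q ^ n)
      + (s / L)\<^sup>2 / 2 * q * ((real n)\<^sup>2 * q ^ n + 5 * (real n * q ^ n) + 6 * q ^ n)" for n
    unfolding corrector''_def q_def[symmetric] by (simp add: power_add power2_eq_square field_simps)
  note intros = tendsto_diff tendsto_add tendsto_mult_left lims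
  show "(\<lambda>n. corrector L n s) \<longlonglongrightarrow> 0"
  proof (cases "s = 0")
    case False
    have "(\<lambda>n. corrector L n s) \<longlonglongrightarrow> s\<^sup>2 / 2 * q ^ 3 * 0"
      unfolding 0 by (intro intros q False)
    then show ?thesis by simp
  qed (simp add: corrector_def)
  show "(\<lambda>n. corrector' L n s) \<longlonglongrightarrow> 0"
  proof (cases "s = 0")
    case False
    have "(\<lambda>n. corrector' L n s) \<longlonglongrightarrow> s * q ^ 3 * 0 - s\<^sup>2 / (2 * L) * q\<^sup>2 * (0 + 3 * 0)"
      unfolding 1 by (intro intros q False)
    then show ?thesis by simp
  qed (simp add: corrector'_def)
  show "(\<lambda>n. corrector'' L n s) \<longlonglongrightarrow> 0" if "s \<noteq> 0"
  proof -
    have "(\<lambda>n. corrector'' L n s) \<longlonglongrightarrow> q ^ 3 * 0 - 2 * (s / L) * q\<^sup>2 * (0 + 3 * 0)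
        + (s / L)\<^sup>2 / 2 * q * (0 + 5 * 0 + 6 * 0)"
      unfolding 2 by (intro intros q that)
    then show ?thesis by simp
  qed
qed

lemma corrector_derivs:
  assumes L: "0 < L"
  shows "(corrector L n has_real_derivative corrector' L n s) (at s)"
    and "(corrector' L n has_real_derivative corrector'' L n s) (at s)"
proof -
  have p: "((\<lambda>s. (1 - s / L) ^ Suc k) has_real_derivative - real (Suc k) / L * (1 - s / L) ^ k) (at s)" for k s
  proof -
    have "((\<lambda>s. 1 - s / L) has_real_derivative - 1 / L) (at s)"
      using L by (auto intro!: derivative_eq_intros)
    from DERIV_power[OF this, of "Suc k"] show ?thesis by (simp del: power_Suc of_nat_Suc add: mult_ac)
  qed
  define Q where "Q = 1 - s / L"
  have q: "((\<lambda>s. s\<^sup>2 / 2) has_real_derivative s) (at s)"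
    and q': "((\<lambda>s. real (n + 3) * s\<^sup>2 / (2 * L)) has_real_derivative real (n + 3) * s / L) (at s)"
    using L by (auto intro!: derivative_eq_intros)
  have "((\<lambda>s. s\<^sup>2 / 2 * (1 - s / L) ^ Suc (n + 2)) has_real_derivative corrector' L n s) (at s)"
    by (rule DERIV_cong[OF DERIV_mult[OF q p]])
      (use L in \<open>simp add: corrector'_def numeral_3_eq_3 field_simps flip: Q_def\<close>)
  then show "(corrector L n has_real_derivative corrector' L n s) (at s)"
    by (simp add: corrector_def[abs_def] numeral_3_eq_3)
  have "((\<lambda>s. s * (1 - s / L) ^ Suc (n + 2) - real (n + 3) * s\<^sup>2 / (2 * L) * (1 - s / L) ^ Suc (n + 1))
      has_real_derivative corrector'' L n s) (at s)"
    by (rule DERIV_cong[OF DERIV_diff[OF DERIV_mult[OF DERIV_ident p] DERIV_mult[OF q' p]]])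
      (use L in \<open>simp add: corrector''_def numeral_3_eq_3 power2_eq_square field_simps flip: Q_def\<close>)
  then show "(corrector' L n has_real_derivative corrector'' L n s) (at s)"
    by (simp add: corrector'_def[abs_def] numeral_3_eq_3)
qed

text \<open>
  The constants \<open>c\<close> and \<open>d\<close> prescribe the second derivatives at the two ends of the edge.
\<close>

lemma corrector_C2_along:
  assumes L: "0 < L"
  shows "C2_along L (\<lambda>s. c * corrector L n s + d * corrector L n (L - s))
     (\<lambda>s. c * corrector' L n s - d * corrector' L n (L - s))
     (\<lambda>s. c * corrector'' L n s + d * corrector'' L n (L - s))"
proof -
  have refl: "((\<lambda>s. f (L - s)) has_real_derivative - f' (L - s)) (at s)"
    if "\<And>s. (f has_real_derivative f' s) (at s)" for f f' :: "real \<Rightarrow> real" and s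
  proof -
    have "((\<lambda>s. L - s) has_real_derivative - 1) (at s)" by (auto intro!: derivative_eq_intros)
    from DERIV_chain2[OF that this] show ?thesis by simp
  qed
  note d = corrector_derivs[OF L]
  have "((\<lambda>s. c * corrector L n s + d * corrector L n (L - s)) has_real_derivative
      c * corrector' L n s - d * corrector' L n (L - s)) (at s)" for s
    using DERIV_add[OF DERIV_cmult[OF d(1)] DERIV_cmult[OF refl[OF d(1)]]] by simp
  moreover have "((\<lambda>s. c * corrector' L n s - d * corrector' L n (L - s)) has_real_derivative
      c * corrector'' L n s + d * corrector'' L n (L - s)) (at s)" for s
    using DERIV_diff[OF DERIV_cmult[OF d(2)] DERIV_cmult[OF refl[OF d(2)]]] by simp
  moreover have "continuous_on {0..L} (\<lambda>s. c * corrector'' L n s + d * corrector'' L n (L - s))"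
    unfolding corrector''_def using L by (intro continuous_intros) auto
  ultimately show ?thesis
    unfolding C2_along_def by (blast intro: has_field_derivative_at_within)
qed

section \<open>Bounded pointwise closure of the controlled operator\<close>

text \<open>
  This is the controlled operator with the continuity of \<open>g\<close> dropped: the value \<open>g v\<close> at a vertex is
  tied to \<open>f\<close> by the vertex condition alone and need not be the limit of \<open>g\<close> along any edge. At an
  inner vertex with positive stickiness the condition determines \<open>g v\<close>; at every other vertex
  \<open>g v\<close> is free.
\<close>

definition relaxed_operator ::
  "('a::euclidean_space, 'e, 'z) control_problem_scheme \<Rightarrow> ('a \<Rightarrow> real)
     \<Rightarrow> (('a \<Rightarrow> real) \<times> ('a \<Rightarrow> real)) set" where
  "relaxed_operator N a = {(f, g). f \<in> Ck_net 2 N \<and>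
     (\<forall>\<alpha>\<in>edges N. \<forall>x\<in>seg N \<alpha> - verts N.
        g x = diffusivity N \<alpha> * edge_deriv 2 N \<alpha> f x + drift N x (a x) * edge_deriv 1 N \<alpha> f x) \<and>
     (\<forall>v\<in>inner_verts N.
        stickiness N v * g v
          + (\<Sum>\<alpha>\<in>edges_at N v. diffusivity N \<alpha> * weight N v \<alpha> * outward_deriv N \<alpha> f v) = 0) \<and>
     (\<forall>v\<in>boundary_verts N. \<forall>\<alpha>\<in>edges_at N v. outward_deriv N \<alpha> f v = 0)}"

lemma controlled_operator_eq:
  "controlled_operator N a = {(f, g). (f, g) \<in> relaxed_operator N a \<and> g \<in> C_net N}"
  by (auto simp: controlled_operator_def relaxed_operator_def)

lemma Ck_net_2E:
  assumes "u \<in> Ck_net 2 N"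
  obtains u' u'' where
    "\<And>\<alpha>. \<alpha> \<in> edges N \<Longrightarrow> C2_along (len N \<alpha>) (on_edge N \<alpha> u) (u' \<alpha>) (u'' \<alpha>)"
  using assms unfolding Ck_net_def Ck_interval_2_iff by (auto simp: Ball_def) metis

lemma controlled_data_edge_extendable:
  assumes cp: "is_control_problem N" and a: "a \<in> PC_net N" and \<alpha>: "\<alpha> \<in> edges N"
  shows "edge_extendable N \<alpha> (\<lambda>x. drift N x (a x))"
    and "edge_extendable N \<alpha> (\<lambda>x. running_cost N x (a x))"
proof -
  have net: "is_network N" using cp by (simp add: is_control_problem_def)
  obtain A where A: "continuous_on {0..len N \<alpha>} A"
    "\<And>s. s \<in> {0<..<len N \<alpha>} \<Longrightarrow> A s = a (param N \<alpha> s)"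
    using edge_extendableE[OF PC_net_edge_extendable[OF net a \<alpha>]] by blast
  have comp: "edge_extendable N \<alpha> (\<lambda>x. k x (a x))"
    if "continuous_on (seg N \<alpha> \<times> UNIV) (\<lambda>(x, a). k x a)" for k :: "'a \<Rightarrow> real \<Rightarrow> real"
  proof -
    have "continuous_on {0..len N \<alpha>} (\<lambda>s. (\<lambda>(x, a). k x a) (param N \<alpha> s, A s))"
      using param_in_seg[OF net \<alpha>]
      by (intro continuous_on_compose2[OF that] continuous_on_Pair continuous_on_param[OF net] A(1)) auto
    then show ?thesis
      unfolding edge_extendable_def on_edge_def using A(2)
      by (intro exI[of _ "\<lambda>s. k (param N \<alpha> s) (A s)"]) simp
  qed
  show "edge_extendable N \<alpha> (\<lambda>x. drift N x (a x))"
    "edge_extendable N \<alpha> (\<lambda>x. running_cost N x (a x))"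
    using cp \<alpha> unfolding is_control_problem_def by (blast intro: comp)+
qed

text \<open>
  Adding correctors to \<open>w\<close> on every edge moves the limits of the operator at the ends of the edge to the
  prescribed vertex values \<open>G v\<close>, so that \<open>g n\<close> becomes continuous. As the correctors have slope
  \<open>0\<close> at the vertices, the outward derivatives and with them the vertex conditions are unchanged.
\<close>

lemma relaxed_operator_approximation:
  assumes cp: "is_control_problem N" and a: "a \<in> PC_net N" and wG: "(w, G) \<in> relaxed_operator N a"
  shows "\<exists>f g C. (\<forall>n::nat. (f n, g n) \<in> controlled_operator N a) \<and>
    (\<forall>n. \<forall>x\<in>net_set N. \<bar>f n x\<bar> \<le> C \<and> \<bar>g n x\<bar> \<le> C) \<and>
    (\<forall>x\<in>net_set N. (\<lambda>n. f n x) \<longlonglongrightarrow> w x \<and> (\<lambda>n. g n x) \<longlonglongrightarrow> G x)"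
proof -
  have net: "is_network N" using cp by (simp add: is_control_problem_def)
  have w: "w \<in> Ck_net 2 N"
    and G_edge: "\<And>\<alpha> x. \<alpha> \<in> edges N \<Longrightarrow> x \<in> seg N \<alpha> - verts N \<Longrightarrow>
        G x = diffusivity N \<alpha> * edge_deriv 2 N \<alpha> w x + drift N x (a x) * edge_deriv 1 N \<alpha> w x"
    and G_inner: "\<And>v. v \<in> inner_verts N \<Longrightarrow> stickiness N v * G v
          + (\<Sum>\<alpha>\<in>edges_at N v. diffusivity N \<alpha> * weight N v \<alpha> * outward_deriv N \<alpha> w v) = 0"
    and w_boundary: "\<And>v \<alpha>. v \<in> boundary_verts N \<Longrightarrow> \<alpha> \<in> edges_at N v \<Longrightarrow> outward_deriv N \<alpha> w v = 0"
    using wG unfolding relaxed_operator_def by auto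
  have \<mu>: "0 < diffusivity N \<alpha>" if "\<alpha> \<in> edges N" for \<alpha>
    using cp that unfolding is_control_problem_def by blast
  note L = len_pos[OF net]
  obtain w' w'' where C2: "\<And>\<alpha>. \<alpha> \<in> edges N \<Longrightarrow> C2_along (len N \<alpha>) (on_edge N \<alpha> w) (w' \<alpha>) (w'' \<alpha>)"
    using Ck_net_2E[OF w] by blast
  obtain B where B_cont: "\<And>\<alpha>. \<alpha> \<in> edges N \<Longrightarrow> continuous_on {0..len N \<alpha>} (B \<alpha>)"
    and B: "\<And>\<alpha> s. \<alpha> \<in> edges N \<Longrightarrow> s \<in> {0<..<len N \<alpha>} \<Longrightarrow>
        B \<alpha> s = drift N (param N \<alpha> s) (a (param N \<alpha> s))"
    using controlled_data_edge_extendable(1)[OF cp a]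
    unfolding edge_extendable_def on_edge_def by metis
  \<comment> \<open>The continuous extension to the closed edge of the values of \<open>G\<close> inside the edge; its end values
    may differ from the vertex values of \<open>G\<close>.\<close>
  define G0 where "G0 \<alpha> s = diffusivity N \<alpha> * w'' \<alpha> s + B \<alpha> s * w' \<alpha> s" for \<alpha> s
  \<comment> \<open>The second derivative contributes to the operator with the factor \<open>diffusivity N \<alpha>\<close>, hence the
    quotient.\<close>
  define c where "c \<alpha> = (G (source N \<alpha>) - G0 \<alpha> 0) / diffusivity N \<alpha>" for \<alpha>
  define d where "d \<alpha> = (G (target N \<alpha>) - G0 \<alpha> (len N \<alpha>)) / diffusivity N \<alpha>" for \<alpha>
  define \<phi> where "\<phi> n \<alpha> s = c \<alpha> * corrector (len N \<alpha>) n s + d \<alpha> * corrector (len N \<alpha>) n (len N \<alpha> - s)"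
    for n \<alpha> s
  define \<phi>' where "\<phi>' n \<alpha> s = c \<alpha> * corrector' (len N \<alpha>) n s - d \<alpha> * corrector' (len N \<alpha>) n (len N \<alpha> - s)"
    for n \<alpha> s
  define \<phi>'' where "\<phi>'' n \<alpha> s = c \<alpha> * corrector'' (len N \<alpha>) n s + d \<alpha> * corrector'' (len N \<alpha>) n (len N \<alpha> - s)"
    for n \<alpha> s
  define fe where "fe n \<alpha> s = on_edge N \<alpha> w s + \<phi> n \<alpha> s" for n \<alpha> s
  define ge where "ge n \<alpha> s = G0 \<alpha> s + diffusivity N \<alpha> * \<phi>'' n \<alpha> s + B \<alpha> s * \<phi>' n \<alpha> s" for n \<alpha> s
  define f where "f n = glue N w (fe n)" for n
  define g where "g n = glue N G (ge n)" for n
  have \<phi>_C2: "C2_along (len N \<alpha>) (\<phi> n \<alpha>) (\<phi>' n \<alpha>) (\<phi>'' n \<alpha>)" if "\<alpha> \<in> edges N" for n \<alpha>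
    unfolding \<phi>_def[abs_def] \<phi>'_def[abs_def] \<phi>''_def[abs_def] by (rule corrector_C2_along[OF L[OF that]])
  have \<phi>_ends: "\<phi> n \<alpha> 0 = 0" "\<phi>' n \<alpha> 0 = 0" "\<phi>'' n \<alpha> 0 = c \<alpha>"
    "\<phi> n \<alpha> (len N \<alpha>) = 0" "\<phi>' n \<alpha> (len N \<alpha>) = 0" "\<phi>'' n \<alpha> (len N \<alpha>) = d \<alpha>"
    if "\<alpha> \<in> edges N" for n \<alpha>
    using L[OF that] by (simp_all add: \<phi>_def \<phi>'_def \<phi>''_def corrector_endpoints)
  have f_param: "f n (param N \<alpha> s) = fe n \<alpha> s" if "\<alpha> \<in> edges N" "s \<in> {0..len N \<alpha>}" for n \<alpha> s
    unfolding f_def using that param_len[OF net that(1)]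
    by (intro glue_param[OF net]) (auto simp: fe_def \<phi>_ends on_edge_def param_0[OF net])
  have g_param: "g n (param N \<alpha> s) = ge n \<alpha> s" if "\<alpha> \<in> edges N" "s \<in> {0..len N \<alpha>}" for n \<alpha> s
    unfolding g_def using that \<mu>[OF that(1)]
    by (intro glue_param[OF net]) (auto simp: ge_def \<phi>_ends c_def d_def)
  have f_C2: "C2_along (len N \<alpha>) (on_edge N \<alpha> (f n)) (\<lambda>s. w' \<alpha> s + \<phi>' n \<alpha> s) (\<lambda>s. w'' \<alpha> s + \<phi>'' n \<alpha> s)"
    if "\<alpha> \<in> edges N" for n \<alpha>
    by (rule C2_along_cong[OF C2_along_add[OF C2[OF that] \<phi>_C2[OF that]]])
      (simp add: on_edge_def[of _ _ "f n"] f_param[OF that] fe_def)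
  have f_net: "f n \<in> Ck_net 2 N" for n
    unfolding Ck_net_def C_net_def Ck_interval_2_iff
    using f_C2 by (blast intro: continuous_on_net[OF net] C2_along_continuous(1))
  have ge_cont: "continuous_on {0..len N \<alpha>} (ge n \<alpha>)" if "\<alpha> \<in> edges N" for n \<alpha>
    unfolding ge_def[abs_def] G0_def
    by (intro continuous_intros B_cont C2_along_continuous[OF C2] C2_along_continuous[OF \<phi>_C2] that)
  have g_net: "g n \<in> C_net N" for n
    unfolding C_net_def mem_Collect_eq
  proof (rule continuous_on_net[OF net])
    fix \<alpha> assume "\<alpha> \<in> edges N"
    then show "continuous_on {0..len N \<alpha>} (on_edge N \<alpha> (g n))"
      using g_param by (intro continuous_on_cong[THEN iffD2, OF refl _ ge_cont]) (auto simp: on_edge_def)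
  qed
  have outward: "outward_deriv N \<alpha> (f n) v = outward_deriv N \<alpha> w v" if "\<alpha> \<in> edges N" for n \<alpha> v
    unfolding outward_deriv_eq[OF net that C2[OF that]] outward_deriv_eq[OF net that f_C2[OF that]]
    using \<phi>_ends[OF that] by simp
  have g_vertex: "g n v = G v" if "v \<in> verts N" for n v
    unfolding g_def by (rule glue_vertex[OF net that])
  have G_param: "G (param N \<alpha> s) = G0 \<alpha> s" if "\<alpha> \<in> edges N" "s \<in> {0<..<len N \<alpha>}" for \<alpha> s
    using G_edge[OF that(1) param_interior[OF net that]] param_interior[OF net that] that
      dist_param[OF net that(1), of s] B[OF that]
    by (simp add: edge_deriv_1[OF net that(1) C2[OF that(1)]] edge_deriv_2[OF net that(1) C2[OF that(1)]]
        G0_def del: One_nat_def)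
  have ctrl: "(f n, g n) \<in> controlled_operator N a" for n
    unfolding controlled_operator_eq relaxed_operator_def mem_Collect_eq prod.case
  proof (intro conjI ballI f_net g_net)
    fix \<alpha> x assume \<alpha>: "\<alpha> \<in> edges N" and x: "x \<in> seg N \<alpha> - verts N"
    define s where "s = dist (source N \<alpha>) x"
    have s: "s \<in> {0<..<len N \<alpha>}" "param N \<alpha> s = x"
      using interior_param[OF net \<alpha> x] seg_param(2)[OF net \<alpha>] x by (auto simp: s_def)
    have "g n x = ge n \<alpha> s" using g_param[OF \<alpha>, of s n] s by simp
    also have "\<dots> = diffusivity N \<alpha> * (w'' \<alpha> s + \<phi>'' n \<alpha> s) + drift N x (a x) * (w' \<alpha> s + \<phi>' n \<alpha> s)"
      using B[OF \<alpha> s(1)] s(2) by (simp add: ge_def G0_def algebra_simps)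
    finally show "g n x = diffusivity N \<alpha> * edge_deriv 2 N \<alpha> (f n) x + drift N x (a x) * edge_deriv 1 N \<alpha> (f n) x"
      using x by (simp add: edge_deriv_1[OF net \<alpha> f_C2[OF \<alpha>]] edge_deriv_2[OF net \<alpha> f_C2[OF \<alpha>]] s_def
          del: One_nat_def)
  next
    fix v assume v: "v \<in> inner_verts N"
    have "(\<Sum>\<alpha>\<in>edges_at N v. diffusivity N \<alpha> * weight N v \<alpha> * outward_deriv N \<alpha> (f n) v)
        = (\<Sum>\<alpha>\<in>edges_at N v. diffusivity N \<alpha> * weight N v \<alpha> * outward_deriv N \<alpha> w v)"
      by (intro sum.cong refl) (simp add: edges_at_def outward)
    then show "stickiness N v * g n v
          + (\<Sum>\<alpha>\<in>edges_at N v. diffusivity N \<alpha> * weight N v \<alpha> * outward_deriv N \<alpha> (f n) v) = 0"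
      using G_inner[OF v] g_vertex v by (simp add: inner_verts_def)
  next
    fix v \<alpha> assume "v \<in> boundary_verts N" "\<alpha> \<in> edges_at N v"
    then show "outward_deriv N \<alpha> (f n) v = 0"
      using w_boundary outward by (simp add: edges_at_def)
  qed
  have "\<exists>C. \<forall>n. \<forall>x\<in>net_set N. \<bar>f n x\<bar> \<le> C"
  proof (rule net_uniform_bound[OF net])
    fix \<alpha> assume \<alpha>: "\<alpha> \<in> edges N"
    obtain C where C: "\<And>s. s \<in> {0..len N \<alpha>} \<Longrightarrow> \<bar>on_edge N \<alpha> w s\<bar> \<le> C"
      using continuous_on_Icc_bounded[OF C2_along_continuous(1)[OF C2[OF \<alpha>]]] by blast
    have "\<bar>f n (param N \<alpha> s)\<bar> \<le> C + (\<bar>c \<alpha>\<bar> * (len N \<alpha>)\<^sup>2 + \<bar>d \<alpha>\<bar> * (len N \<alpha>)\<^sup>2)"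
      if s: "s \<in> {0<..<len N \<alpha>}" for n s
    proof -
      have "\<bar>\<phi> n \<alpha> s\<bar> \<le> \<bar>c \<alpha>\<bar> * (len N \<alpha>)\<^sup>2 + \<bar>d \<alpha>\<bar> * (len N \<alpha>)\<^sup>2"
        unfolding \<phi>_def using s
        by (intro order_trans[OF abs_triangle_ineq] add_mono)
          (auto simp: abs_mult intro!: mult_left_mono corrector_bounds(1)[OF L[OF \<alpha>]])
      then show ?thesis using C[of s] s f_param[OF \<alpha>, of s n] by (simp add: fe_def)
    qed
    then show "\<exists>C. \<forall>n. \<forall>s\<in>{0<..<len N \<alpha>}. \<bar>f n (param N \<alpha> s)\<bar> \<le> C" by blast
  qed (auto simp: f_def glue_vertex[OF net])
  then obtain Cf where Cf: "\<And>n x. x \<in> net_set N \<Longrightarrow> \<bar>f n x\<bar> \<le> Cf" by blast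
  have "\<exists>C. \<forall>n. \<forall>x\<in>net_set N. \<bar>g n x\<bar> \<le> C"
  proof (rule net_uniform_bound[OF net])
    fix \<alpha> assume \<alpha>: "\<alpha> \<in> edges N"
    have G0_cont: "continuous_on {0..len N \<alpha>} (G0 \<alpha>)"
      unfolding G0_def[abs_def] by (intro continuous_intros B_cont C2_along_continuous[OF C2] \<alpha>)
    obtain C where C: "\<And>s. s \<in> {0..len N \<alpha>} \<Longrightarrow> \<bar>G0 \<alpha> s\<bar> \<le> C"
      using continuous_on_Icc_bounded[OF G0_cont] by blast
    obtain D where D: "\<And>s. s \<in> {0..len N \<alpha>} \<Longrightarrow> \<bar>B \<alpha> s\<bar> \<le> D"
      using continuous_on_Icc_bounded[OF B_cont[OF \<alpha>]] by blast
    have "\<bar>g n (param N \<alpha> s)\<bar> \<le> C + diffusivity N \<alpha> * (\<bar>c \<alpha>\<bar> * 4 + \<bar>d \<alpha>\<bar> * 4)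
         + D * (\<bar>c \<alpha>\<bar> * (2 * len N \<alpha>) + \<bar>d \<alpha>\<bar> * (2 * len N \<alpha>))"
      if s: "s \<in> {0<..<len N \<alpha>}" for n s
    proof -
      have "\<bar>\<phi>'' n \<alpha> s\<bar> \<le> \<bar>c \<alpha>\<bar> * 4 + \<bar>d \<alpha>\<bar> * 4"
        unfolding \<phi>''_def using s
        by (intro order_trans[OF abs_triangle_ineq] add_mono)
          (auto simp: abs_mult intro!: mult_left_mono corrector_bounds(3)[OF L[OF \<alpha>]])
      then have 1: "\<bar>diffusivity N \<alpha> * \<phi>'' n \<alpha> s\<bar> \<le> diffusivity N \<alpha> * (\<bar>c \<alpha>\<bar> * 4 + \<bar>d \<alpha>\<bar> * 4)"
        using \<mu>[OF \<alpha>] by (auto simp: abs_mult intro!: mult_left_mono)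
      have "\<bar>\<phi>' n \<alpha> s\<bar> \<le> \<bar>c \<alpha>\<bar> * (2 * len N \<alpha>) + \<bar>d \<alpha>\<bar> * (2 * len N \<alpha>)"
        unfolding \<phi>'_def using s
        by (intro order_trans[OF abs_triangle_ineq4] add_mono)
          (auto simp: abs_mult intro!: mult_left_mono corrector_bounds(2)[OF L[OF \<alpha>]])
      then have 2: "\<bar>B \<alpha> s * \<phi>' n \<alpha> s\<bar> \<le> D * (\<bar>c \<alpha>\<bar> * (2 * len N \<alpha>) + \<bar>d \<alpha>\<bar> * (2 * len N \<alpha>))"
        using D[of s] s unfolding abs_mult by (intro mult_mono) auto
      have triangle: "\<bar>x + y + z\<bar> \<le> p + q + r" if "\<bar>x\<bar> \<le> p" "\<bar>y\<bar> \<le> q" "\<bar>z\<bar> \<le> r"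
        for x y z p q r :: real
        using that by linarith
      have "g n (param N \<alpha> s) = G0 \<alpha> s + diffusivity N \<alpha> * \<phi>'' n \<alpha> s + B \<alpha> s * \<phi>' n \<alpha> s"
        using g_param[OF \<alpha>, of s n] s by (simp add: ge_def)
      moreover have "\<bar>G0 \<alpha> s\<bar> \<le> C" using C s by simp
      ultimately show ?thesis
        using triangle[OF _ 1 2] by simp
    qed
    then show "\<exists>C. \<forall>n. \<forall>s\<in>{0<..<len N \<alpha>}. \<bar>g n (param N \<alpha> s)\<bar> \<le> C" by blast
  qed (auto simp: g_def glue_vertex[OF net])
  then obtain Cg where Cg: "\<And>n x. x \<in> net_set N \<Longrightarrow> \<bar>g n x\<bar> \<le> Cg" by blast
  have lim: "(\<lambda>n. f n x) \<longlonglongrightarrow> w x \<and> (\<lambda>n. g n x) \<longlonglongrightarrow> G x" if x: "x \<in> net_set N" for x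
    using net x
  proof (cases rule: net_set_cases)
    case vertex
    then show ?thesis by (simp add: f_def g_def glue_vertex[OF net])
  next
    case (interior \<alpha> s)
    note \<alpha> = interior(1) and s = interior(2)
    have s': "s \<in> {0..len N \<alpha>}" "len N \<alpha> - s \<in> {0..len N \<alpha>}" "s \<noteq> 0" "len N \<alpha> - s \<noteq> 0"
      using s by auto
    note t = corrector_tendsto_0[OF L[OF \<alpha>] s'(1)] corrector_tendsto_0[OF L[OF \<alpha>] s'(2)]
    have 0: "(\<lambda>n. \<phi> n \<alpha> s) \<longlonglongrightarrow> 0"
      unfolding \<phi>_def using tendsto_add[OF tendsto_mult_left[OF t(1)] tendsto_mult_left[OF t(4)]] by simp
    have 1: "(\<lambda>n. \<phi>' n \<alpha> s) \<longlonglongrightarrow> 0"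
      unfolding \<phi>'_def using tendsto_diff[OF tendsto_mult_left[OF t(2)] tendsto_mult_left[OF t(5)]] by simp
    have 2: "(\<lambda>n. \<phi>'' n \<alpha> s) \<longlonglongrightarrow> 0"
      unfolding \<phi>''_def
      using tendsto_add[OF tendsto_mult_left[OF t(3)[OF s'(3)]] tendsto_mult_left[OF t(6)[OF s'(4)]]] by simp
    have "(\<lambda>n. fe n \<alpha> s) \<longlonglongrightarrow> on_edge N \<alpha> w s + 0"
      unfolding fe_def by (intro tendsto_add tendsto_const 0)
    moreover have "(\<lambda>n. ge n \<alpha> s) \<longlonglongrightarrow> G0 \<alpha> s + diffusivity N \<alpha> * 0 + B \<alpha> s * 0"
      unfolding ge_def by (intro tendsto_add tendsto_mult_left tendsto_const 1 2)
    ultimately show ?thesis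
      using f_param[OF \<alpha> s'(1)] g_param[OF \<alpha> s'(1)] G_param[OF \<alpha> s] interior(3)
      by (simp add: on_edge_def)
  qed
  have "\<bar>f n x\<bar> \<le> max Cf Cg \<and> \<bar>g n x\<bar> \<le> max Cf Cg" if "x \<in> net_set N" for n x
    using Cf[OF that, of n] Cg[OF that, of n] by (simp add: le_max_iff_disj)
  with ctrl lim show ?thesis by (intro exI[of _ f] exI[of _ g] exI[of _ "max Cf Cg"]) simp
qed

lemma relaxed_operator_edge_extendable:
  assumes cp: "is_control_problem N" and a: "a \<in> PC_net N" and wG: "(w, G) \<in> relaxed_operator N a"
    and \<alpha>: "\<alpha> \<in> edges N"
  shows "edge_extendable N \<alpha> (\<lambda>x. lam * w x - G x)"
proof -
  have net: "is_network N" using cp by (simp add: is_control_problem_def)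
  have w: "w \<in> Ck_net 2 N"
    and G: "\<And>\<alpha> x. \<alpha> \<in> edges N \<Longrightarrow> x \<in> seg N \<alpha> - verts N \<Longrightarrow>
        G x = diffusivity N \<alpha> * edge_deriv 2 N \<alpha> w x + drift N x (a x) * edge_deriv 1 N \<alpha> w x"
    using wG unfolding relaxed_operator_def by auto
  obtain w' w'' where C2: "C2_along (len N \<alpha>) (on_edge N \<alpha> w) w' w''"
    using Ck_net_2E[OF w] \<alpha> by metis
  obtain B where B: "continuous_on {0..len N \<alpha>} B"
    "\<And>s. s \<in> {0<..<len N \<alpha>} \<Longrightarrow> B s = drift N (param N \<alpha> s) (a (param N \<alpha> s))"
    using edge_extendableE[OF controlled_data_edge_extendable(1)[OF cp a \<alpha>]] by blast
  show ?thesis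
    unfolding edge_extendable_def
  proof (intro exI conjI ballI)
    show "continuous_on {0..len N \<alpha>} (\<lambda>s. lam * on_edge N \<alpha> w s - (diffusivity N \<alpha> * w'' s + B s * w' s))"
      by (intro continuous_intros B C2_along_continuous[OF C2])
    fix s assume s: "s \<in> {0<..<len N \<alpha>}"
    then show "lam * on_edge N \<alpha> w s - (diffusivity N \<alpha> * w'' s + B s * w' s)
        = on_edge N \<alpha> (\<lambda>x. lam * w x - G x) s"
      using G[OF \<alpha> param_interior[OF net \<alpha> s]] param_interior[OF net \<alpha> s] dist_param[OF net \<alpha>, of s] B(2)[OF s]
      by (simp add: on_edge_def edge_deriv_1[OF net \<alpha> C2] edge_deriv_2[OF net \<alpha> C2] del: One_nat_def)
  qed
qed

text \<open>
  The resolvent identity is stable under bounded pointwise convergence, by dominated convergence for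
  the occupation measure.
\<close>

lemma relaxed_operator_occupation:
  assumes cp: "is_control_problem N" and a: "a \<in> PC_net N" and x: "x \<in> net_set N"
    and FP: "feller_process M X (net_set N) (controlled_operator N a) x" and lam: "0 < lam"
    and wG: "(w, G) \<in> relaxed_operator N a"
  shows "(LINT y:net_set N|continuous_process.occupation M X lam. lam * w y - G y) = lam * w x"
proof -
  have net: "is_network N" using cp by (simp add: is_control_problem_def)
  let ?S = "net_set N"
  interpret continuous_process M X ?S lam
    by (rule feller_process_occupation(1)[OF FP compact_net_set[OF net] lam])
  interpret occ: prob_space occupation by (rule prob_space_occupation)
  obtain f g C where fg: "\<And>n::nat. (f n, g n) \<in> controlled_operator N a"
    and bound: "\<And>n y. y \<in> ?S \<Longrightarrow> \<bar>f n y\<bar> \<le> C \<and> \<bar>g n y\<bar> \<le> C"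
    and lim: "\<And>y. y \<in> ?S \<Longrightarrow> (\<lambda>n. f n y) \<longlonglongrightarrow> w y \<and> (\<lambda>n. g n y) \<longlonglongrightarrow> G y"
    using relaxed_operator_approximation[OF cp a wG] by blast
  have ident: "(LINT y:?S|occupation. lam * f n y - g n y) = lam * f n x" for n
    by (rule feller_process_occupation(2)[OF FP compact_net_set[OF net] lam fg])
  have cont: "continuous_on ?S (\<lambda>y. lam * f n y - g n y)" for n
    using fg[of n] by (intro continuous_intros) (auto simp: controlled_operator_def Ck_net_def C_net_def)
  have meas: "(\<lambda>y. indicator ?S y *\<^sub>R (lam * f n y - g n y)) \<in> borel_measurable occupation" for n
    using set_borel_measurable_S[OF cont]
    by (simp add: set_borel_measurable_def cong: measurable_cong_sets)
  have pointwise: "(\<lambda>n. indicator ?S y *\<^sub>R (lam * f n y - g n y)) \<longlonglongrightarrow> indicator ?S y *\<^sub>R (lam * w y - G y)" for y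
    using lim[of y] by (cases "y \<in> ?S") (auto intro!: tendsto_intros)
  have "(\<lambda>n. LINT y:?S|occupation. lam * f n y - g n y) \<longlonglongrightarrow> (LINT y:?S|occupation. lam * w y - G y)"
    unfolding set_lebesgue_integral_def
  proof (rule integral_dominated_convergence[where w = "\<lambda>_. lam * \<bar>C\<bar> + \<bar>C\<bar>"])
    show "(\<lambda>y. indicator ?S y *\<^sub>R (lam * w y - G y)) \<in> borel_measurable occupation"
      by (rule borel_measurable_LIMSEQ_real[OF pointwise meas])
    have "\<bar>lam * f n y - g n y\<bar> \<le> lam * \<bar>C\<bar> + \<bar>C\<bar>" if "y \<in> ?S" for n y
    proof -
      have "\<bar>lam * f n y\<bar> \<le> lam * \<bar>C\<bar>"
        using bound[OF that, of n] lam by (auto simp: abs_mult)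
      then show ?thesis using bound[OF that, of n] by linarith
    qed
    then show "AE y in occupation. norm (indicator ?S y *\<^sub>R (lam * f n y - g n y)) \<le> lam * \<bar>C\<bar> + \<bar>C\<bar>" for n
      using lam by (intro AE_I2) (simp add: indicator_def)
  qed (use meas pointwise in auto)
  moreover have "(\<lambda>n. LINT y:?S|occupation. lam * f n y - g n y) \<longlonglongrightarrow> lam * w x"
    unfolding ident using lim[OF x] by (intro tendsto_intros) auto
  ultimately show ?thesis by (rule LIMSEQ_unique)
qed

text \<open>
  The relaxed operator is not single-valued: the vertex condition at \<open>v\<close> holds for \<open>f = 0\<close> and
  \<open>g v = 1\<close> because the stickiness vanishes or the condition does not involve \<open>g\<close>.
\<close>

lemma nonsticky_vertex_indicator:
  assumes net: "is_network N"
    and v: "v \<in> inner_verts N \<Longrightarrow> stickiness N v = 0"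
    and vv: "v \<in> verts N"
  shows "((\<lambda>_. 0), indicator {v}) \<in> relaxed_operator N a"
proof -
  have C2: "C2_along (len N \<alpha>) (on_edge N \<alpha> (\<lambda>_. 0)) (\<lambda>_. 0) (\<lambda>_. 0)" for \<alpha>
    by (simp add: C2_along_def on_edge_def)
  have "(\<lambda>_. 0) \<in> Ck_net 2 N"
    unfolding Ck_net_def C_net_def Ck_interval_2_iff using C2 by auto
  moreover have "edge_deriv 1 N \<alpha> (\<lambda>_. 0) x = 0" "edge_deriv 2 N \<alpha> (\<lambda>_. 0) x = 0"
    if "\<alpha> \<in> edges N" "x \<in> seg N \<alpha>" for \<alpha> x
    using edge_deriv_1[OF net that(1) C2 that(2)] edge_deriv_2[OF net that(1) C2 that(2)] by simp_all
  moreover have "outward_deriv N \<alpha> (\<lambda>_. 0) x = 0" if "\<alpha> \<in> edges_at N x" for \<alpha> x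
    using that outward_deriv_eq[OF net _ C2] by (simp add: edges_at_def)
  ultimately show ?thesis
    unfolding relaxed_operator_def using v vv
    by (auto simp: indicator_def simp del: One_nat_def)
qed

text \<open>
  The resolvent identity for the pair \<open>(0, indicator {v})\<close> says that the occupation measure of \<open>{v}\<close>
  is zero: the process spends no time at a vertex that is not sticky.
\<close>

lemma occupation_nonsticky_vertex:
  assumes cp: "is_control_problem N" and a: "a \<in> PC_net N" and x: "x \<in> net_set N"
    and FP: "feller_process M X (net_set N) (controlled_operator N a) x" and lam: "0 < lam"
    and v: "v \<in> verts N" "v \<in> inner_verts N \<Longrightarrow> stickiness N v = 0"
  shows "AE y in continuous_process.occupation M X lam. y \<noteq> v"
proof -
  have net: "is_network N" using cp by (simp add: is_control_problem_def)
  interpret continuous_process M X "net_set N" lam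
    by (rule feller_process_occupation(1)[OF FP compact_net_set[OF net] lam])
  interpret occ: prob_space occupation by (rule prob_space_occupation)
  have "(LINT y:net_set N|occupation. lam * 0 - indicator {v} y) = lam * 0"
    by (rule relaxed_operator_occupation[OF cp a x FP lam nonsticky_vertex_indicator[OF net v(2,1)]])
  also have "(LINT y:net_set N|occupation. lam * 0 - indicator {v} y) = (LINT y|occupation. - indicator {v} y)"
    unfolding set_lebesgue_integral_def using vertex_in_net_set[OF net v(1)]
    by (intro Bochner_Integration.integral_cong) (auto simp: indicator_def)
  finally have "measure occupation {v} = 0" by simp
  then have "{v} \<in> null_sets occupation"
    by (simp add: null_sets_def occ.emeasure_eq_measure)
  then show ?thesis using AE_not_in by fastforce
qed

section \<open>The Hamilton-Jacobi-Bellman inequality\<close>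

text \<open>
  The set where the bound fails is open, and a nonempty open set is not negligible.
\<close>

lemma continuous_bound_of_AE_bound:
  fixes h :: "real \<Rightarrow> real"
  assumes cont: "continuous_on {0<..<L} h"
    and AE: "AE s in restrict_space lborel {0<..<L}. ereal \<bar>h s\<bar> \<le> ereal R"
    and s: "s \<in> {0<..<L}"
  shows "\<bar>h s\<bar> \<le> R"
proof (rule ccontr)
  assume "\<not> \<bar>h s\<bar> \<le> R"
  let ?U = "{0<..<L} \<inter> (\<lambda>s. \<bar>h s\<bar>) -` {R<..}"
  have U: "open ?U"
    by (rule continuous_open_preimage) (auto intro!: continuous_intros cont)
  have "AE s in lborel. s \<in> {0<..<L} \<longrightarrow> \<bar>h s\<bar> \<le> R"
    using AE by (subst (asm) AE_restrict_space_iff) auto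
  then have "AE s in lborel. s \<notin> ?U" by eventually_elim auto
  then have "?U \<in> null_sets lborel"
    using U by (subst (asm) AE_iff_null_sets[symmetric]) auto
  then have "negligible ?U"
    by (simp add: negligible_iff_null_sets null_sets_completionI)
  moreover have "s \<in> ?U" using s \<open>\<not> \<bar>h s\<bar> \<le> R\<close> by auto
  ultimately show False using open_not_negligible[OF U] by blast
qed

lemma control_bounded:
  assumes net: "is_network N" and a: "a \<in> controls N"
    and \<alpha>: "\<alpha> \<in> edges N" and s: "s \<in> {0<..<len N \<alpha>}"
  shows "\<bar>a (param N \<alpha> s)\<bar> \<le> control_bound N"
proof -
  let ?M = "restrict_space lborel {0<..<len N \<alpha>}"
  let ?e = "\<lambda>\<alpha>. esssup (restrict_space lborel {0<..<len N \<alpha>}) (\<lambda>s. ereal \<bar>on_edge N \<alpha> a s\<bar>)"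
  have "?e \<alpha> \<le> PC_norm N a"
    unfolding PC_norm_def using finite_edges[OF net] \<alpha> by (intro Max_ge) auto
  also have "\<dots> \<le> ereal (control_bound N)" using a unfolding controls_def by auto
  finally have le: "?e \<alpha> \<le> ereal (control_bound N)" .
  have "AE s in ?M. ereal \<bar>on_edge N \<alpha> a s\<bar> \<le> ereal (control_bound N)"
    using esssup_AE[of "\<lambda>s. ereal \<bar>on_edge N \<alpha> a s\<bar>" ?M]
    by (rule eventually_mono) (rule order_trans[OF _ le])
  then have "\<bar>on_edge N \<alpha> a s\<bar> \<le> control_bound N"
    by (rule continuous_bound_of_AE_bound[rotated]) (use a \<alpha> s in \<open>auto simp: controls_def PC_net_def\<close>)
  then show ?thesis by (simp add: on_edge_def)
qed

text \<open>
  The supremum is that of a continuous function on a compact interval of control values, hence taken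
  over a bounded set of reals.
\<close>

lemma hamiltonian_ge:
  assumes cp: "is_control_problem N" and \<alpha>: "\<alpha> \<in> edges N" and x: "x \<in> seg N \<alpha>"
    and b: "\<bar>b\<bar> \<le> control_bound N"
  shows "- drift N x b * p - running_cost N x b \<le> hamiltonian N x p"
proof -
  let ?h = "\<lambda>b. - drift N x b * p - running_cost N x b"
  have slice: "continuous_on UNIV (k x)"
    if "continuous_on (seg N \<alpha> \<times> UNIV) (\<lambda>(x, a). k x a)" for k :: "'a \<Rightarrow> real \<Rightarrow> real"
  proof -
    have "continuous_on UNIV (\<lambda>b. (\<lambda>(x, a). k x a) (x, b))"
      using x by (intro continuous_on_compose2[OF that] continuous_intros) auto
    then show ?thesis by simp
  qed
  have "continuous_on UNIV (drift N x)" "continuous_on UNIV (running_cost N x)"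
    using cp \<alpha> unfolding is_control_problem_def by (auto intro!: slice)
  then have "continuous_on {- control_bound N..control_bound N} ?h"
    by (intro continuous_intros) (auto intro: continuous_on_subset)
  moreover have "{a. \<bar>a\<bar> \<le> control_bound N} = {- control_bound N..control_bound N}" by auto
  ultimately have "bdd_above (?h ` {a. \<bar>a\<bar> \<le> control_bound N})"
    by (simp add: bounded_imp_bdd_above compact_continuous_image compact_imp_bounded)
  then show ?thesis
    unfolding hamiltonian_def by (rule cSUP_upper[rotated]) (use b in simp)
qed

definition cost_integrand ::
  "('a::euclidean_space, 'e, 'z) control_problem_scheme \<Rightarrow> ('a \<Rightarrow> real) \<Rightarrow> 'a \<Rightarrow> real" where
  "cost_integrand N a y = (running_cost N y (a y) + extra_cost N y) * indicator (- verts N) y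
         + (\<Sum>v\<in>inner_verts N. vertex_cost N v * indicator {v} y)"

lemma cost_integrand_vertex:
  assumes "is_network N" "v \<in> inner_verts N"
  shows "cost_integrand N a v = vertex_cost N v"
proof -
  have "(\<Sum>w\<in>inner_verts N. vertex_cost N w * indicator {w} v) = (\<Sum>w\<in>inner_verts N. if w = v then vertex_cost N w else 0)"
    by (intro sum.cong) (auto simp: indicator_def)
  then show ?thesis
    using assms finite_verts[OF assms(1)] by (simp add: cost_integrand_def inner_verts_def indicator_def)
qed

lemma cost_integrand_interior:
  assumes "y \<notin> verts N"
  shows "cost_integrand N a y = running_cost N y (a y) + extra_cost N y"
proof -
  have "(\<Sum>v\<in>inner_verts N. vertex_cost N v * indicator {v} y) = 0"
    using assms by (intro sum.neutral) (auto simp: inner_verts_def indicator_def)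
  then show ?thesis using assms by (simp add: cost_integrand_def)
qed

lemma cost_integrand_edge_extendable:
  assumes cp: "is_control_problem N" and a: "a \<in> PC_net N" and \<alpha>: "\<alpha> \<in> edges N"
  shows "edge_extendable N \<alpha> (cost_integrand N a)"
proof -
  have net: "is_network N" using cp by (simp add: is_control_problem_def)
  obtain K where K: "continuous_on {0..len N \<alpha>} K"
    "\<And>s. s \<in> {0<..<len N \<alpha>} \<Longrightarrow> K s = running_cost N (param N \<alpha> s) (a (param N \<alpha> s))"
    using edge_extendableE[OF controlled_data_edge_extendable(2)[OF cp a \<alpha>]] by blast
  have "extra_cost N \<in> PC_net N" using cp by (simp add: is_control_problem_def)
  then obtain F where F: "continuous_on {0..len N \<alpha>} F"
    "\<And>s. s \<in> {0<..<len N \<alpha>} \<Longrightarrow> F s = extra_cost N (param N \<alpha> s)"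
    using edge_extendableE[OF PC_net_edge_extendable[OF net _ \<alpha>]] by blast
  have "on_edge N \<alpha> (cost_integrand N a) s = K s + F s" if "s \<in> {0<..<len N \<alpha>}" for s
    using param_interior[OF net \<alpha> that] K(2)[OF that] F(2)[OF that]
    by (simp add: on_edge_def cost_integrand_interior)
  then show ?thesis
    unfolding edge_extendable_def
    using continuous_on_add[OF K(1) F(1)] by (intro exI[of _ "\<lambda>s. K s + F s"]) simp
qed

text \<open>
  At an inner vertex with positive stickiness the Kirchhoff condition for \<open>u\<close> is the vertex condition of
  the operator with \<open>G v = \<lambda> u v - \<theta>\<^sub>v\<close>, which makes \<open>\<lambda> u - G\<close> equal to the vertex cost. At all other
  vertices it is the vertex condition for every value of \<open>G v\<close>. Inside the edges the
  control value \<open>a x\<close> competes in the supremum that defines the Hamiltonian.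
\<close>

lemma HJB_solution_relaxed:
  assumes cp: "is_control_problem N" and a: "a \<in> controls N"
    and u: "u \<in> Ck_net 2 N" and HJB: "HJB_solution N u"
  obtains G where "(u, G) \<in> relaxed_operator N a"
    "\<And>y. y \<in> net_set N \<Longrightarrow> y \<notin> verts N \<Longrightarrow> discount N * u y - G y \<le> cost_integrand N a y"
    "\<And>v. v \<in> inner_verts N \<Longrightarrow> stickiness N v \<noteq> 0 \<Longrightarrow> discount N * u v - G v = cost_integrand N a v"
proof -
  have net: "is_network N" using cp by (simp add: is_control_problem_def)
  obtain u' u'' where C2: "\<And>\<alpha>. \<alpha> \<in> edges N \<Longrightarrow> C2_along (len N \<alpha>) (on_edge N \<alpha> u) (u' \<alpha>) (u'' \<alpha>)"
    using Ck_net_2E[OF u] by blast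
  define G where "G = glue N (\<lambda>v. if stickiness N v = 0 then 0 else discount N * u v - vertex_cost N v)
    (\<lambda>\<alpha> s. diffusivity N \<alpha> * u'' \<alpha> s + drift N (param N \<alpha> s) (a (param N \<alpha> s)) * u' \<alpha> s)"
  have G_interior: "G (param N \<alpha> s) = diffusivity N \<alpha> * u'' \<alpha> s
      + drift N (param N \<alpha> s) (a (param N \<alpha> s)) * u' \<alpha> s"
    if "\<alpha> \<in> edges N" "s \<in> {0<..<len N \<alpha>}" for \<alpha> s
    unfolding G_def by (rule glue_interior[OF net that])
  have G_edge: "G x = diffusivity N \<alpha> * edge_deriv 2 N \<alpha> u x + drift N x (a x) * edge_deriv 1 N \<alpha> u x"
    if \<alpha>: "\<alpha> \<in> edges N" and x: "x \<in> seg N \<alpha> - verts N" for \<alpha> x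
    using G_interior[OF \<alpha> interior_param[OF net \<alpha> x]] x seg_param(2)[OF net \<alpha>, of x]
    by (simp add: edge_deriv_1[OF net \<alpha> C2[OF \<alpha>]] edge_deriv_2[OF net \<alpha> C2[OF \<alpha>]] del: One_nat_def)
  have G_vertex: "G v = (if stickiness N v = 0 then 0 else discount N * u v - vertex_cost N v)"
    if "v \<in> verts N" for v
    unfolding G_def by (rule glue_vertex[OF net that])
  show thesis
  proof
    show "(u, G) \<in> relaxed_operator N a"
      unfolding relaxed_operator_def mem_Collect_eq prod.case
    proof (intro conjI ballI)
      fix v assume v: "v \<in> inner_verts N"
      then have "(\<Sum>\<alpha>\<in>edges_at N v. diffusivity N \<alpha> * weight N v \<alpha> * outward_deriv N \<alpha> u v)
          = stickiness N v * (vertex_cost N v - discount N * u v)"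
        using HJB unfolding HJB_solution_def by blast
      then show "stickiness N v * G v
          + (\<Sum>\<alpha>\<in>edges_at N v. diffusivity N \<alpha> * weight N v \<alpha> * outward_deriv N \<alpha> u v) = 0"
        using G_vertex[of v] v by (simp add: inner_verts_def right_diff_distrib)
    next
      fix v \<alpha> assume "v \<in> boundary_verts N" "\<alpha> \<in> edges_at N v"
      then show "outward_deriv N \<alpha> u v = 0" using HJB unfolding HJB_solution_def by blast
    qed (use u G_edge in auto)
  next
    fix y assume "y \<in> net_set N" "y \<notin> verts N"
    then obtain \<alpha> s where \<alpha>: "\<alpha> \<in> edges N" and s: "s \<in> {0<..<len N \<alpha>}" "y = param N \<alpha> s"
      using net by (auto elim: net_set_cases)
    have y: "y \<in> seg N \<alpha> - verts N" using param_interior[OF net \<alpha> s(1)] s(2) by simp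
    have "- diffusivity N \<alpha> * edge_deriv 2 N \<alpha> u y + hamiltonian N y (edge_deriv 1 N \<alpha> u y)
          + discount N * u y = extra_cost N y"
      using HJB \<alpha> y unfolding HJB_solution_def by blast
    moreover have "- drift N y (a y) * edge_deriv 1 N \<alpha> u y - running_cost N y (a y)
        \<le> hamiltonian N y (edge_deriv 1 N \<alpha> u y)"
      using y control_bounded[OF net a \<alpha> s(1)] s(2) by (intro hamiltonian_ge[OF cp \<alpha>]) auto
    ultimately show "discount N * u y - G y \<le> cost_integrand N a y"
      using G_edge[OF \<alpha> y] y by (simp add: cost_integrand_interior)
  next
    fix v assume "v \<in> inner_verts N" "stickiness N v \<noteq> 0"
    then show "discount N * u v - G v = cost_integrand N a v"
      using G_vertex[of v] cost_integrand_vertex[OF net, of v a] by (simp add: inner_verts_def)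
  qed
qed

section \<open>Comparison with the cost\<close>

text \<open>
  Both sides are integrals for the occupation measure \<open>\<nu>\<close>:
  \<open>\<lambda> u x = \<integral> (\<lambda> u - G) d\<nu> \<le> \<integral> k d\<nu> = \<lambda> J(x, a)\<close> with the running cost \<open>k\<close>. The inequality may
  fail at vertices that are not sticky, but these carry no mass.
\<close>

lemma solution_le_cost:
  assumes cp: "is_control_problem N" and a: "a \<in> controls N" and x: "x \<in> net_set N"
    and FP: "feller_process M X (net_set N) (controlled_operator N a) x"
    and u: "u \<in> Ck_net 2 N" and HJB: "HJB_solution N u"
  shows "u x \<le> cost N M X a"
proof -
  have net: "is_network N" and lam: "0 < discount N" using cp by (auto simp: is_control_problem_def)
  have aPC: "a \<in> PC_net N" using a by (simp add: controls_def)
  let ?S = "net_set N" and ?lam = "discount N" and ?k = "cost_integrand N a"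
  interpret continuous_process M X ?S ?lam
    by (rule feller_process_occupation(1)[OF FP compact_net_set[OF net] lam])
  obtain G where G: "(u, G) \<in> relaxed_operator N a"
    "\<And>y. y \<in> ?S \<Longrightarrow> y \<notin> verts N \<Longrightarrow> ?lam * u y - G y \<le> ?k y"
    "\<And>v. v \<in> inner_verts N \<Longrightarrow> stickiness N v \<noteq> 0 \<Longrightarrow> ?lam * u v - G v = ?k v"
    using HJB_solution_relaxed[OF cp a u HJB] by metis
  have integrable: "set_integrable occupation ?S h"
    if "\<And>\<alpha>. \<alpha> \<in> edges N \<Longrightarrow> edge_extendable N \<alpha> h" for h :: "'a \<Rightarrow> real"
    using set_integrable_occupation[OF edge_extendable_bounded_measurable(1)[OF net that]]
      edge_extendable_bounded_measurable(2)[OF net that] by blast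
  have null: "AE y in occupation. \<forall>v\<in>{v \<in> verts N. v \<in> inner_verts N \<longrightarrow> stickiness N v = 0}. y \<noteq> v"
    using finite_verts[OF net] occupation_nonsticky_vertex[OF cp aPC x FP lam]
    by (intro AE_finite_allI) auto
  have "?lam * u x = (LINT y:?S|occupation. ?lam * u y - G y)"
    by (rule relaxed_operator_occupation[OF cp aPC x FP lam G(1), symmetric])
  also have "\<dots> \<le> (LINT y:?S|occupation. ?k y)"
  proof (rule set_integral_mono_AE)
    show "set_integrable occupation ?S (\<lambda>y. ?lam * u y - G y)"
      by (rule integrable) (rule relaxed_operator_edge_extendable[OF cp aPC G(1)])
    show "set_integrable occupation ?S ?k"
      by (rule integrable) (rule cost_integrand_edge_extendable[OF cp aPC])
    show "AE y \<in> ?S in occupation. ?lam * u y - G y \<le> ?k y"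
      using null
    proof eventually_elim
      case (elim y)
      show ?case
      proof (cases "y \<in> verts N")
        case True
        with elim have "y \<in> inner_verts N" "stickiness N y \<noteq> 0" by blast+
        then show ?thesis using G(3)[of y] by simp
      qed (use G(2)[of y] in simp)
    qed
  qed
  also have "\<dots> = ?lam * cost N M X a"
  proof -
    obtain C where "\<And>y. y \<in> ?S \<Longrightarrow> \<bar>?k y\<bar> \<le> C"
      using edge_extendable_bounded_measurable(2)[OF net cost_integrand_edge_extendable[OF cp aPC]] by blast
    then show ?thesis
      using occupation_set_integral_paths[OF edge_extendable_bounded_measurable(1)[OF net
          cost_integrand_edge_extendable[OF cp aPC]], of C]
      by (simp add: cost_def cost_integrand_def)
  qed
  finally show ?thesis using lam by simp
qed

text \<open>
  The value function is an infimum of reals, so the set of controls has to be nonempty. A point of the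
  network provides the edge without which the norm would be the maximum of an empty set.
\<close>

lemma zero_control:
  assumes cp: "is_control_problem N" and x: "x \<in> net_set N"
  shows "(\<lambda>_. 0) \<in> controls N"
proof -
  have net: "is_network N" and R: "0 < control_bound N" using cp by (auto simp: is_control_problem_def)
  have "edges N \<noteq> {}" using x by (auto simp: net_set_def)
  moreover have "esssup (restrict_space lborel {0<..<len N \<alpha>}) (\<lambda>s. ereal \<bar>on_edge N \<alpha> (\<lambda>_. 0) s\<bar>) \<le> ereal (control_bound N)"
    for \<alpha>
    using R by (intro esssup_I) (auto simp: on_edge_def)
  ultimately have "PC_norm N (\<lambda>_. 0) \<le> ereal (control_bound N)"
    unfolding PC_norm_def using finite_edges[OF net] by (intro Max.boundedI) auto
  then show ?thesis
    by (auto simp: controls_def PC_net_def on_edge_def)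
qed

theorem theorem4p7:
  fixes N :: "('a::euclidean_space, 'e) control_problem"
    and M :: "('a \<Rightarrow> real) \<Rightarrow> 'a \<Rightarrow> 'w measure"
    and X :: "('a \<Rightarrow> real) \<Rightarrow> 'a \<Rightarrow> real \<Rightarrow> 'w \<Rightarrow> 'a"
    and u :: "'a \<Rightarrow> real"
  assumes "is_control_problem N"
    and "\<And>a x. a \<in> controls N \<Longrightarrow> x \<in> net_set N \<Longrightarrow>
           feller_process (M a x) (X a x) (net_set N) (controlled_operator N a) x"
    and "u \<in> Ck_net 2 N"
    and "HJB_solution N u"
  shows "(\<forall>a\<in>controls N. \<forall>x\<in>net_set N. u x \<le> cost N (M a x) (X a x) a) \<and>
         (\<forall>x\<in>net_set N. u x \<le> value_function N M X x)"
proof -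
  have le: "u x \<le> cost N (M a x) (X a x) a" if "a \<in> controls N" "x \<in> net_set N" for a x
    using assms that by (intro solution_le_cost) auto
  moreover have "u x \<le> value_function N M X x" if x: "x \<in> net_set N" for x
    unfolding value_function_def using le[OF _ x] zero_control[OF assms(1) x]
    by (intro cINF_greatest) auto
  ultimately show ?thesis by blast
qed

end
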